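(* Assume $n=2t$ is even and let $\mathbb{L}'$ be the subfield with $\mathbb{K}\le\mathbb{L}'<\mathbb{L}$ and $[\mathbb{L}:\mathbb{L}']=2$. Let $F(y)\in\mathbb{K}[y]$ be monic irreducible of degree $s$, $F(y)\ne y$, $m$ the number of irreducible factors of $F(x^n)$ in $R$, $\ell=n/m$, and $f$ a monic irreducible factor of $F(x^n)$ with $f\notin Z(R)$. Let $\gamma\in\mathbb{L}^*$ and $$\mathcal{C}=D_{n,s\ell,k}(\gamma,F)=\Big\{a_0'+\sum_{i=1}^{sk\ell-1}a_ix^i+\gamma a_0''x^{sk\ell}+RF(x^n): a_i\in\mathbb{L},\ a_0',a_0''\in\mathbb{L}'\Big\}.$$ Assume $1\le k\le m/2$ and $sk\ell\ge2$. Then $$\mathcal{I}_\ell(\mathcal{C})\cong\mathbb{L}',\quad\mathcal{I}_r(\mathcal{C})\cong\mathbb{L}',\quad C(\mathcal{C})\cong E_F,\quad Z(\mathcal{C})\cong\mathbb{K}.$$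
   Context: $\mathbb{K}$ is a field, $\mathbb{L}/\mathbb{K}$ cyclic Galois of degree $n$, $\sigma$ a generator of $\mathrm{Gal}(\mathbb{L}/\mathbb{K})$, $R=\mathbb{L}[x;\sigma]$ with $xa=\sigma(a)x$, $Z(R)=\mathbb{K}[x^n]$. $E_F\cong\mathbb{K}[y]/(F(y))$ is the centre of $M=R/RF(x^n)$. For $\mathcal{C}\subseteq M$: $\mathcal{I}_\ell(\mathcal{C})=\{A\in M:A\mathcal{C}\subseteq\mathcal{C}\}$, $\mathcal{I}_r(\mathcal{C})=\{B\in M:\mathcal{C}B\subseteq\mathcal{C}\}$, $C(\mathcal{C})=\{A\in M:AX=XA\ \forall X\in\mathcal{C}\}$, $Z(\mathcal{C})=\mathcal{I}_\ell(\mathcal{C})\cap C(\mathcal{C})$. *)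

theory Defs
  imports "HOL-Algebra.Algebra"
begin

abbreviation subring_on :: "('a, 'b) ring_scheme \<Rightarrow> 'a set \<Rightarrow> ('a, 'b) ring_scheme"
  where "subring_on A S \<equiv> A\<lparr>carrier := S\<rparr>"

section \<open>Cyclic Galois extensions\<close>

text \<open>As in the library's \<^const>\<open>AutoGroup\<close>, automorphisms are extensional on
  \<^term>\<open>carrier L\<close>, so that each is represented by exactly one function.\<close>

definition galois_group ::
    "('a, 'b) ring_scheme \<Rightarrow> 'a set \<Rightarrow> ('a \<Rightarrow> 'a) monoid"
  where "galois_group L K = BijGroup (carrier L)
    \<lparr>carrier := {\<tau> \<in> Bij (carrier L). \<tau> \<in> ring_hom L L \<and> (\<forall>a\<in>K. \<tau> a = a)}\<rparr>"

text \<open>An extension of finite degree is Galois iff the fixed field of its group is the base field.\<close>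

definition galois_extension_of_degree ::
    "nat \<Rightarrow> ('a, 'b) ring_scheme \<Rightarrow> 'a set \<Rightarrow> bool"
  where "galois_extension_of_degree n L K \<longleftrightarrow>
    field L \<and> subfield K L \<and> ring.dimension L n K (carrier L) \<and>
    {a \<in> carrier L. \<forall>\<tau>\<in>carrier (galois_group L K). \<tau> a = a} = K"


section \<open>Skew polynomials\<close>

text \<open>The library's \<^const>\<open>UP\<close> with the product twisted by \<open>\<sigma>\<close>:
  \<open>(a x\<^sup>i) (b x\<^sup>j) = a \<sigma>\<^sup>i(b) x\<^sup>i\<^sup>+\<^sup>j\<close>, in particular \<open>x a = \<sigma>(a) x\<close>.\<close>

definition skew_UP ::
    "('a, 'b) ring_scheme \<Rightarrow> ('a \<Rightarrow> 'a) \<Rightarrow> ('a, nat \<Rightarrow> 'a) up_ring"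
  where "skew_UP L \<sigma> = (UP L)
    \<lparr>mult := (\<lambda>p\<in>up L. \<lambda>q\<in>up L. \<lambda>n.
       \<Oplus>\<^bsub>L\<^esub>i \<in> {..n}. p i \<otimes>\<^bsub>L\<^esub> (\<sigma> ^^ i) (q (n - i)))\<rparr>"

text \<open>\<open>F(x\<^sup>n)\<close> as an element of the skew polynomial ring \<open>R\<close>, for \<open>F \<in> K[y]\<close>.\<close>

definition eval_at_xn ::
    "('a, 'b) ring_scheme \<Rightarrow> 'a set \<Rightarrow> ('a, nat \<Rightarrow> 'a) up_ring \<Rightarrow> nat \<Rightarrow> (nat \<Rightarrow> 'a) \<Rightarrow> (nat \<Rightarrow> 'a)"
  where "eval_at_xn L K R n F =
    UnivPoly.eval (subring_on L K) R (\<lambda>a. up_ring.monom R a 0)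
      (up_ring.monom R \<one>\<^bsub>L\<^esub> 1 [^]\<^bsub>R\<^esub> n) F"

definition monic :: "('a, 'b) ring_scheme \<Rightarrow> (nat \<Rightarrow> 'a) \<Rightarrow> bool"
  where "monic L p \<longleftrightarrow> p (deg L p) = \<one>\<^bsub>L\<^esub>"


section \<open>Invariants of a subset of a ring\<close>

definition left_idealizer :: "('a, 'b) ring_scheme \<Rightarrow> 'a set \<Rightarrow> 'a set"
  where "left_idealizer M \<C> = {A \<in> carrier M. \<forall>Y\<in>\<C>. A \<otimes>\<^bsub>M\<^esub> Y \<in> \<C>}"

definition right_idealizer :: "('a, 'b) ring_scheme \<Rightarrow> 'a set \<Rightarrow> 'a set"
  where "right_idealizer M \<C> = {B \<in> carrier M. \<forall>Y\<in>\<C>. Y \<otimes>\<^bsub>M\<^esub> B \<in> \<C>}"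

definition centralizer :: "('a, 'b) ring_scheme \<Rightarrow> 'a set \<Rightarrow> 'a set"
  where "centralizer M \<C> = {A \<in> carrier M. \<forall>Y\<in>\<C>. A \<otimes>\<^bsub>M\<^esub> Y = Y \<otimes>\<^bsub>M\<^esub> A}"

text \<open>The centre of a code is relative to its left idealizer; it differs from
  the centre \<open>ring_center\<close> of a ring, used for \<open>Z(R)\<close> and \<open>E\<^sub>F\<close>.\<close>

definition code_center :: "('a, 'b) ring_scheme \<Rightarrow> 'a set \<Rightarrow> 'a set"
  where "code_center M \<C> = left_idealizer M \<C> \<inter> centralizer M \<C>"

definition ring_center :: "('a, 'b) ring_scheme \<Rightarrow> 'a set"
  where "ring_center M = {A \<in> carrier M. \<forall>Y\<in>carrier M. A \<otimes>\<^bsub>M\<^esub> Y = Y \<otimes>\<^bsub>M\<^esub> A}"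


section \<open>The codes\<close>

text \<open>\<open>D_code L L' R I d \<gamma>\<close> is the set \<open>D\<^sub>n\<^sub>,\<^sub>s\<^sub>l\<^sub>,\<^sub>k(\<gamma>, F)\<close> for
  \<open>I = R F(x\<^sup>n)\<close> and \<open>d = s k l\<close>.\<close>

definition D_code ::
    "('a, 'b) ring_scheme \<Rightarrow> 'a set \<Rightarrow> ('a, nat \<Rightarrow> 'a) up_ring \<Rightarrow> (nat \<Rightarrow> 'a) set \<Rightarrow> nat \<Rightarrow> 'a
      \<Rightarrow> (nat \<Rightarrow> 'a) set set"
  where "D_code L L' R I d \<gamma> =
    {I +>\<^bsub>R\<^esub> (up_ring.monom R a0' 0
        \<oplus>\<^bsub>R\<^esub> (\<Oplus>\<^bsub>R\<^esub>i \<in> {1..d - 1}. up_ring.monom R (a i) i)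
        \<oplus>\<^bsub>R\<^esub> up_ring.monom R (\<gamma> \<otimes>\<^bsub>L\<^esub> a0'') d)
     | a0' a a0''. a0' \<in> L' \<and> a0'' \<in> L' \<and> (\<forall>i \<in> {1..d - 1}. a i \<in> carrier L)}"

end

theory Submission
  imports Defs
begin

text \<open>Put \<open>d = s k l\<close>. As \<open>l = n div m\<close> and \<open>2 k \<le> m\<close>, we have \<open>2 d \<le> s n\<close>. Every class of \<open>M\<close>
  has exactly one representative of degree below \<open>s n\<close>, so products whose degrees add up to less than \<open>s n\<close> can be
  compared coefficientwise.

  The code contains \<open>1\<close> and all \<open>b x\<^sup>i\<close> with \<open>0 < i < d\<close>. Containing \<open>1\<close>, it contains its
  idealizers, and multiplication by \<open>b x\<^sup>d\<^sup>-\<^sup>1\<close> for varying \<open>b\<close> shows that their elements are constants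
  from \<open>L'\<close>; conversely \<open>L'\<close> is \<open>\<sigma>\<close>-invariant, because it is the fixed field of a power of \<open>\<sigma>\<close>.
  An element commuting with \<open>b x\<close> for all \<open>b\<close> is central in \<open>M\<close>, as \<open>F(0) \<noteq> 0\<close> makes \<open>x\<close>
  invertible in \<open>M\<close>. Finally \<open>\<sigma>\<close> has order exactly \<open>n\<close>, so that the centre of \<open>M\<close> consists of the
  classes of \<open>K[x\<^sup>n]\<close>.\<close>

section \<open>Skew polynomial rings\<close>

text \<open>The hypotheses describe the extension only through its degree, a generator of the group
  and the fixed field of that group; the order of \<open>\<sigma>\<close> and the position of
  \<open>L'\<close> have to be extracted from this. The tool is to read a skew polynomial as the
  operator \<open>p_0 + p_1 \<sigma> + ... + p_e \<sigma>^e\<close> on \<open>L\<close>. Such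
  operators can be divided by \<open>\<sigma> - c\<close> like polynomials, with
  \<open>c = \<sigma>(b)/b\<close> corresponding to a root \<open>b\<close>. Hence an operator of
  degree \<open>e\<close> kills at most \<open>e\<close> elements independent over \<open>K\<close>,
  and every subspace of dimension \<open>u\<close> is killed by a nonzero operator of degree at most
  \<open>u\<close>. The first fact bounds the order of \<open>\<sigma>\<close> from below by
  \<open>n\<close>. The second, joined with Dedekind's argument for the independence of characters,
  bounds it from above, and it applies to \<open>L'\<close> as well as to \<open>L\<close>. The
  noncommutative quotient stays manageable because \<open>F(x^n)\<close> is both central and monic:
  its left multiples form a two-sided ideal, and division by it proceeds as for ordinary
  polynomials.\<close>

locale skew_poly_ring = ring L for L (structure) +
  fixes \<sigma> :: "'a \<Rightarrow> 'a"
  assumes sigma_hom: "\<sigma> \<in> ring_hom L L"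
begin

abbreviation R where "R \<equiv> skew_UP L \<sigma>"
abbreviation mon where "mon \<equiv> up_ring.monom R"

section \<open>Powers of \<sigma> as ring endomorphisms\<close>

lemma funpow_hom: "(\<sigma> ^^ i) \<in> ring_hom L L"
proof (induct i)
  case 0 show ?case using id_ring_hom by (simp add: id_def)
next
  case (Suc i) then show ?case using ring_hom_trans[OF Suc sigma_hom] by (simp add: comp_def)
qed

lemma funpow_ring_hom_ring: "ring_hom_ring L L (\<sigma> ^^ i)"
  using funpow_hom by (simp add: ring_axioms ring_hom_ringI2)

lemma funpow_closed [simp]: "a \<in> carrier L \<Longrightarrow> (\<sigma> ^^ i) a \<in> carrier L"
  using funpow_hom by (rule ring_hom_closed)

lemma funpow_mul [simp]:
  "\<lbrakk>a \<in> carrier L; b \<in> carrier L\<rbrakk> \<Longrightarrow> (\<sigma> ^^ i) (a \<otimes> b) = (\<sigma> ^^ i) a \<otimes> (\<sigma> ^^ i) b"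
  using funpow_hom by (rule ring_hom_mult)

lemma funpow_plus [simp]:
  "\<lbrakk>a \<in> carrier L; b \<in> carrier L\<rbrakk> \<Longrightarrow> (\<sigma> ^^ i) (a \<oplus> b) = (\<sigma> ^^ i) a \<oplus> (\<sigma> ^^ i) b"
  using funpow_hom by (rule ring_hom_add)

lemma funpow_one [simp]: "(\<sigma> ^^ i) \<one> = \<one>"
  using funpow_hom by (rule ring_hom_one)

lemma funpow_zero [simp]: "(\<sigma> ^^ i) \<zero> = \<zero>"
proof -
  interpret ring_hom_ring L L "\<sigma> ^^ i" by (rule funpow_ring_hom_ring)
  show ?thesis by (rule hom_zero)
qed

lemma sigma_simps [simp]:
  shows "a \<in> carrier L \<Longrightarrow> \<sigma> a \<in> carrier L" and "\<sigma> \<zero> = \<zero>" and "\<sigma> \<one> = \<one>"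
  using funpow_closed[of a 1] funpow_zero[of 1] funpow_one[of 1] by simp_all

lemma funpow_uminus [simp]: "a \<in> carrier L \<Longrightarrow> (\<sigma> ^^ i) (\<ominus> a) = \<ominus> (\<sigma> ^^ i) a"
proof -
  interpret ring_hom_ring L L "\<sigma> ^^ i" by (rule funpow_ring_hom_ring)
  show "a \<in> carrier L \<Longrightarrow> ?thesis" by (rule hom_a_inv)
qed

lemma funpow_minus:
  "\<lbrakk>a \<in> carrier L; b \<in> carrier L\<rbrakk> \<Longrightarrow> (\<sigma> ^^ i) (a \<ominus> b) = (\<sigma> ^^ i) a \<ominus> (\<sigma> ^^ i) b"
  by (simp add: a_minus_def)

lemma funpow_finsum:
  assumes "finite A" "f \<in> A \<rightarrow> carrier L"
  shows "(\<sigma> ^^ i) (\<Oplus>j\<in>A. f j) = (\<Oplus>j\<in>A. (\<sigma> ^^ i) (f j))"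
  using assms by (induct A) (simp_all add: Pi_def)

lemma funpow_funpow: "(\<sigma> ^^ i) ((\<sigma> ^^ j) a) = (\<sigma> ^^ (i + j)) a"
  by (simp add: funpow_add)

section \<open>Coefficients, monomials and the ring axioms for skew polynomials\<close>

lemma
  shows R_carrier: "carrier R = up L"
    and R_one: "\<one>\<^bsub>R\<^esub> = (\<lambda>i. if i = 0 then \<one> else \<zero>)"
    and R_zero: "\<zero>\<^bsub>R\<^esub> = (\<lambda>i. \<zero>)"
    and R_add_def: "ring.add R = (\<lambda>p\<in>up L. \<lambda>q\<in>up L. \<lambda>i. p i \<oplus> q i)"
    and R_mult_def: "monoid.mult R = (\<lambda>p\<in>up L. \<lambda>q\<in>up L. \<lambda>n. \<Oplus>i\<in>{..n}. p i \<otimes> (\<sigma> ^^ i) (q (n - i)))"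
    and R_monom_def: "mon = (\<lambda>a\<in>carrier L. \<lambda>n i. if i = n then a else \<zero>)"
  by (simp_all add: skew_UP_def UP_def)

lemma coeff_closed [simp]: "p \<in> carrier R \<Longrightarrow> p i \<in> carrier L"
  by (simp add: R_carrier mem_upD)

lemma zero_apply [simp]: "\<zero>\<^bsub>R\<^esub> i = \<zero>" by (simp add: R_zero)
lemma one_apply: "\<one>\<^bsub>R\<^esub> i = (if i = 0 then \<one> else \<zero>)" by (simp add: R_one)

lemma add_apply [simp]: "\<lbrakk>p \<in> carrier R; q \<in> carrier R\<rbrakk> \<Longrightarrow> (p \<oplus>\<^bsub>R\<^esub> q) i = p i \<oplus> q i"
  by (simp add: R_add_def R_carrier)

lemma mult_apply:
  "\<lbrakk>p \<in> carrier R; q \<in> carrier R\<rbrakk> \<Longrightarrow>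
    (p \<otimes>\<^bsub>R\<^esub> q) n = (\<Oplus>i\<in>{..n}. p i \<otimes> (\<sigma> ^^ i) (q (n - i)))"
  by (simp add: R_mult_def R_carrier)

lemma monom_apply: "a \<in> carrier L \<Longrightarrow> mon a n i = (if i = n then a else \<zero>)"
  by (simp add: R_monom_def)

lemma R_memI:
  assumes "\<And>i. p i \<in> carrier L" "\<And>i. N \<le> i \<Longrightarrow> p i = \<zero>" shows "p \<in> carrier R"
  unfolding R_carrier up_def bound_def using assms by (auto intro: less_imp_le)

lemma R_bounded:
  assumes "p \<in> carrier R" obtains N where "\<And>i. N \<le> i \<Longrightarrow> p i = \<zero>"
proof -
  obtain n where "bound \<zero> n p" using assms by (auto simp: R_carrier)
  then have "p i = \<zero>" if "Suc n \<le> i" for i using that by (meson Suc_le_lessD bound.bound)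
  then show ?thesis using that by blast
qed

lemma R_monom_closed [simp, intro]: "a \<in> carrier L \<Longrightarrow> mon a n \<in> carrier R"
  by (rule R_memI[of _ "Suc n"]) (auto simp: monom_apply)

lemma R_mult_closed:
  assumes p: "p \<in> carrier R" and q: "q \<in> carrier R" shows "p \<otimes>\<^bsub>R\<^esub> q \<in> carrier R"
proof -
  obtain N where N: "\<And>i. N \<le> i \<Longrightarrow> p i = \<zero>" using R_bounded[OF p] by blast
  obtain N' where N': "\<And>i. N' \<le> i \<Longrightarrow> q i = \<zero>" using R_bounded[OF q] by blast
  show ?thesis
  proof (rule R_memI[of _ "N + N'"])
    fix i show "(p \<otimes>\<^bsub>R\<^esub> q) i \<in> carrier L"
      using p q by (simp add: mult_apply Pi_def)
  next
    fix i assume i: "N + N' \<le> i"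
    have "p j \<otimes> (\<sigma> ^^ j) (q (i - j)) = \<zero>" for j
    proof (cases "N \<le> j")
      case True then show ?thesis using N q by simp
    next
      case False then have "q (i - j) = \<zero>" using i N' by simp
      then show ?thesis using p by simp
    qed
    then show "(p \<otimes>\<^bsub>R\<^esub> q) i = \<zero>" using p q by (simp add: mult_apply)
  qed
qed

text \<open>Both sides add up the products \<open>a i \<otimes> b i h \<otimes> c (i + h)\<close>
  over \<open>i + h \<le> k\<close>. The middle family has two indices because the coefficients of
  the middle factor are twisted by \<open>\<sigma> ^^ i\<close>, whereas the twist of the last
  factor depends on the total degree \<open>i + h\<close> only and can be absorbed into
  \<open>c\<close>.\<close>

lemma skew_sum_assoc:
  assumes "a \<in> UNIV \<rightarrow> carrier L" "\<And>j. b j \<in> UNIV \<rightarrow> carrier L" "c \<in> UNIV \<rightarrow> carrier L"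
  shows "(\<Oplus>j\<in>{..k::nat}. (\<Oplus>i\<in>{..j}. a i \<otimes> b i (j - i)) \<otimes> c j) =
    (\<Oplus>j\<in>{..k}. a j \<otimes> (\<Oplus>i\<in>{..k - j}. b j i \<otimes> c (j + i)))"
proof (induct k)
  case 0 then show ?case using assms by (simp add: Pi_def m_assoc)
next
  case (Suc k)
  with assms show ?case
    by (simp cong: finsum_cong add: Suc_diff_le Pi_def l_distr r_distr m_assoc)
      (simp cong: finsum_cong add: Pi_def a_ac finsum_ldistr m_assoc)
qed

lemma R_mult_assoc:
  assumes "p \<in> carrier R" "q \<in> carrier R" "r \<in> carrier R"
  shows "(p \<otimes>\<^bsub>R\<^esub> q) \<otimes>\<^bsub>R\<^esub> r = p \<otimes>\<^bsub>R\<^esub> (q \<otimes>\<^bsub>R\<^esub> r)"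
proof
  fix n
  have "((p \<otimes>\<^bsub>R\<^esub> q) \<otimes>\<^bsub>R\<^esub> r) n =
      (\<Oplus>j\<in>{..n}. (\<Oplus>i\<in>{..j}. p i \<otimes> (\<sigma> ^^ i) (q (j - i))) \<otimes> (\<sigma> ^^ j) (r (n - j)))"
    using assms by (simp add: mult_apply R_mult_closed)
  also have "\<dots> = (\<Oplus>j\<in>{..n}. p j \<otimes> (\<Oplus>i\<in>{..n - j}. (\<sigma> ^^ j) (q i \<otimes> (\<sigma> ^^ i) (r (n - j - i)))))"
    using assms by (subst skew_sum_assoc[where b = "\<lambda>i j. (\<sigma> ^^ i) (q j)" and c = "\<lambda>j. (\<sigma> ^^ j) (r (n - j))"])
      (auto simp: funpow_funpow intro!: finsum_cong')
  also have "\<dots> = (\<Oplus>j\<in>{..n}. p j \<otimes> (\<sigma> ^^ j) (\<Oplus>i\<in>{..n - j}. q i \<otimes> (\<sigma> ^^ i) (r (n - j - i))))"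
    using assms by (subst funpow_finsum) (auto simp: Pi_def)
  also have "\<dots> = (p \<otimes>\<^bsub>R\<^esub> (q \<otimes>\<^bsub>R\<^esub> r)) n"
    using assms by (simp add: mult_apply R_mult_closed)
  finally show "((p \<otimes>\<^bsub>R\<^esub> q) \<otimes>\<^bsub>R\<^esub> r) n = (p \<otimes>\<^bsub>R\<^esub> (q \<otimes>\<^bsub>R\<^esub> r)) n" .
qed

lemma finsum_only:
  assumes "finite A" "j \<in> A" "f j \<in> carrier L" "\<And>i. i \<in> A \<Longrightarrow> i \<noteq> j \<Longrightarrow> f i = \<zero>"
  shows "finsum L f A = f j"
proof -
  have "finsum L f A = (\<Oplus>i\<in>A. if j = i then f j else \<zero>)"
    using assms by (intro finsum_cong') auto
  also have "\<dots> = f j" using assms(1-3) add.finprod_singleton[of j A "\<lambda>_. f j"] by auto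
  finally show ?thesis .
qed

text \<open>Multiplying by a monomial only shifts and twists coefficients; later comparisons of
  coefficients go through this rule and its mirror image.\<close>

lemma mult_monom_apply:
  assumes p: "p \<in> carrier R" and a: "a \<in> carrier L"
  shows "(p \<otimes>\<^bsub>R\<^esub> mon a j) n = (if j \<le> n then p (n - j) \<otimes> (\<sigma> ^^ (n - j)) a else \<zero>)"
proof (cases "j \<le> n")
  case True
  have "(p \<otimes>\<^bsub>R\<^esub> mon a j) n = (\<Oplus>i\<in>{..n}. p i \<otimes> (\<sigma> ^^ i) (if n - i = j then a else \<zero>))"
    using assms by (simp add: mult_apply monom_apply)
  also have "\<dots> = p (n - j) \<otimes> (\<sigma> ^^ (n - j)) (if n - (n - j) = j then a else \<zero>)"
    using assms True by (intro finsum_only) auto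
  finally show ?thesis using True by simp
next
  case False
  then have "(p \<otimes>\<^bsub>R\<^esub> mon a j) n = (\<Oplus>i\<in>{..n}. \<zero>)"
    using assms unfolding mult_apply[OF p R_monom_closed[OF a]]
    by (intro finsum_cong') (auto simp: monom_apply)
  then show ?thesis using False by simp
qed

lemma monom_mult_apply:
  assumes p: "p \<in> carrier R" and a: "a \<in> carrier L"
  shows "(mon a j \<otimes>\<^bsub>R\<^esub> p) n = (if j \<le> n then a \<otimes> (\<sigma> ^^ j) (p (n - j)) else \<zero>)"
proof (cases "j \<le> n")
  case True
  have "(mon a j \<otimes>\<^bsub>R\<^esub> p) n = (\<Oplus>i\<in>{..n}. (if i = j then a else \<zero>) \<otimes> (\<sigma> ^^ i) (p (n - i)))"
    using assms by (simp add: mult_apply monom_apply)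
  also have "\<dots> = (if j = j then a else \<zero>) \<otimes> (\<sigma> ^^ j) (p (n - j))"
    using assms True by (intro finsum_only) auto
  finally show ?thesis using True by simp
next
  case False
  then have "(mon a j \<otimes>\<^bsub>R\<^esub> p) n = (\<Oplus>i\<in>{..n}. \<zero>)"
    using assms unfolding mult_apply[OF R_monom_closed[OF a] p]
    by (intro finsum_cong') (auto simp: monom_apply)
  then show ?thesis using False by simp
qed

lemma one_eq_monom: "\<one>\<^bsub>R\<^esub> = mon \<one> 0"
  by (auto simp: one_apply monom_apply)

lemma R_ring: "ring R"
proof (rule ringI)
  show "abelian_group R"
  proof (rule abelian_groupI)
    fix p q assume pq: "p \<in> carrier R" "q \<in> carrier R"
    then show "p \<oplus>\<^bsub>R\<^esub> q \<in> carrier R"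
      by (simp add: R_carrier R_add_def up_add_closed)
    show "p \<oplus>\<^bsub>R\<^esub> q = q \<oplus>\<^bsub>R\<^esub> p" using pq by (auto simp: a_comm)
    fix r assume "r \<in> carrier R"
    then show "(p \<oplus>\<^bsub>R\<^esub> q) \<oplus>\<^bsub>R\<^esub> r = p \<oplus>\<^bsub>R\<^esub> (q \<oplus>\<^bsub>R\<^esub> r)"
      using pq by (auto simp: R_carrier R_add_def up_add_closed mem_upD a_assoc)
  next
    show z: "\<zero>\<^bsub>R\<^esub> \<in> carrier R" by (rule R_memI[of _ 0]) auto
    fix p assume p: "p \<in> carrier R"
    then show "\<zero>\<^bsub>R\<^esub> \<oplus>\<^bsub>R\<^esub> p = p" using z by auto
    have q: "(\<lambda>i. \<ominus> p i) \<in> carrier R" using p by (simp add: R_carrier up_a_inv_closed)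
    then have "(\<lambda>i. \<ominus> p i) \<oplus>\<^bsub>R\<^esub> p = \<zero>\<^bsub>R\<^esub>" using p by (auto simp: l_neg)
    with q show "\<exists>y\<in>carrier R. y \<oplus>\<^bsub>R\<^esub> p = \<zero>\<^bsub>R\<^esub>" by blast
  qed
next
  show "Group.monoid R"
    by (rule monoidI) (auto simp: R_mult_closed R_mult_assoc one_eq_monom monom_mult_apply mult_monom_apply)
next
  fix p q r assume pqr: "p \<in> carrier R" "q \<in> carrier R" "r \<in> carrier R"
  have c: "p \<oplus>\<^bsub>R\<^esub> q \<in> carrier R" using pqr by (simp add: R_carrier R_add_def up_add_closed)
  show "(p \<oplus>\<^bsub>R\<^esub> q) \<otimes>\<^bsub>R\<^esub> r = p \<otimes>\<^bsub>R\<^esub> r \<oplus>\<^bsub>R\<^esub> q \<otimes>\<^bsub>R\<^esub> r"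
    using pqr c by (intro ext) (simp add: R_mult_closed mult_apply l_distr finsum_addf Pi_def)
  show "r \<otimes>\<^bsub>R\<^esub> (p \<oplus>\<^bsub>R\<^esub> q) = r \<otimes>\<^bsub>R\<^esub> p \<oplus>\<^bsub>R\<^esub> r \<otimes>\<^bsub>R\<^esub> q"
    using pqr c by (intro ext) (simp add: R_mult_closed mult_apply r_distr finsum_addf Pi_def)
qed

sublocale R: ring R by (rule R_ring)

lemma uminus_apply [simp]: "p \<in> carrier R \<Longrightarrow> (\<ominus>\<^bsub>R\<^esub> p) i = \<ominus> p i"
  by (metis R.a_inv_closed R.l_neg add_apply coeff_closed minus_equality zero_apply)

lemma minus_apply [simp]: "\<lbrakk>p \<in> carrier R; q \<in> carrier R\<rbrakk> \<Longrightarrow> (p \<ominus>\<^bsub>R\<^esub> q) i = p i \<ominus> q i"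
  by (simp add: a_minus_def)

lemma finsum_apply:
  assumes "finite A" "f \<in> A \<rightarrow> carrier R"
  shows "finsum R f A i = (\<Oplus>j\<in>A. f j i)"
  using assms by (induct A) (simp_all add: Pi_def R.finsum_closed)

lemma monom_mult_monom:
  "\<lbrakk>a \<in> carrier L; b \<in> carrier L\<rbrakk> \<Longrightarrow> mon a i \<otimes>\<^bsub>R\<^esub> mon b j = mon (a \<otimes> (\<sigma> ^^ i) b) (i + j)"
  by (rule ext) (auto simp: monom_mult_apply monom_apply)

lemma monom_pow: "mon \<one> 1 [^]\<^bsub>R\<^esub> (n::nat) = mon \<one> n"
  by (induct n) (simp_all add: one_eq_monom monom_mult_monom)

end


section \<open>Cyclic Galois extensions\<close>

locale cyclic_galois = field L for L (structure) +
  fixes K :: "'a set" and \<sigma> :: "'a \<Rightarrow> 'a" and n :: nat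
  assumes galois: "galois_extension_of_degree n L K"
    and sigma_galois: "\<sigma> \<in> carrier (galois_group L K)"
    and generates: "generate (galois_group L K) {\<sigma>} = carrier (galois_group L K)"
begin

lemma subfield_K: "subfield K L" using galois by (simp add: galois_extension_of_degree_def)
lemma K_subset: "K \<subseteq> carrier L" using subfieldE(3)[OF subfield_K] .
lemma dim_K: "dimension n K (carrier L)" using galois by (simp add: galois_extension_of_degree_def)

end

sublocale cyclic_galois \<subseteq> skew_poly_ring L \<sigma>
  using sigma_galois by unfold_locales (simp add: galois_group_def)

context cyclic_galois
begin

section \<open>From the generator to the Galois group and its fixed field\<close>

lemma sigma_Bij: "\<sigma> \<in> Bij (carrier L)" and sigma_fixes_K: "a \<in> K \<Longrightarrow> \<sigma> a = a"
  using sigma_galois by (auto simp: galois_group_def)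

lemma funpow_fixes: "\<sigma> a = a \<Longrightarrow> (\<sigma> ^^ i) a = a"
  by (induct i) auto

lemma sigma_inj: "inj_on \<sigma> (carrier L)"
  using sigma_Bij by (simp add: Bij_def bij_betw_def)

lemma funpow_inj: "inj_on (\<sigma> ^^ i) (carrier L)"
proof (induct i)
  case (Suc i)
  have "(\<sigma> ^^ i) ` carrier L \<subseteq> carrier L" by auto
  with Suc show ?case
    using comp_inj_on[of "\<sigma> ^^ i" "carrier L" \<sigma>] inj_on_subset[OF sigma_inj] by (simp add: comp_def)
qed (simp add: inj_on_def)

lemma funpow_eq_zero_iff [simp]: "a \<in> carrier L \<Longrightarrow> (\<sigma> ^^ i) a = \<zero> \<longleftrightarrow> a = \<zero>"
  using inj_onD[OF funpow_inj, of i a \<zero>] by auto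

text \<open>Serves to compute inverses: \<open>inv\<close> in \<open>galois_group\<close> is taken
  relative to the smaller carrier, and for a subgroup it agrees with the inverse in
  \<open>BijGroup\<close>, which is the inverse function.\<close>

lemma galois_subgroup:
  "subgroup {\<tau> \<in> Bij (carrier L). \<tau> \<in> ring_hom L L \<and> (\<forall>a\<in>K. \<tau> a = a)} (BijGroup (carrier L))"
    (is "subgroup ?H ?B")
proof (rule subgroup.intro)
  show "?H \<subseteq> carrier ?B" by (auto simp: BijGroup_def)
  show "\<one>\<^bsub>?B\<^esub> \<in> ?H"
    using K_subset by (auto simp: BijGroup_def id_Bij ring_hom_def)
  fix f assume f: "f \<in> ?H"
  then have fi: "f \<in> ring_iso L L" by (simp add: ring_iso_def Bij_def)
  have "inv_into (carrier L) f \<in> ring_hom L L"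
    using ring_iso_set_sym[OF ring_axioms fi] by (simp add: ring_iso_def)
  then have "(\<lambda>x\<in>carrier L. inv_into (carrier L) f x) \<in> ring_hom L L"
    by (simp add: ring_hom_restrict)
  moreover have "inv_into (carrier L) f a = a" if "a \<in> K" for a
  proof -
    have "f a = a" "a \<in> carrier L" using f that K_subset by auto
    moreover have "inj_on f (carrier L)" using f by (simp add: Bij_def bij_betw_def)
    ultimately show ?thesis by (metis inv_into_f_f)
  qed
  ultimately show "inv\<^bsub>?B\<^esub> f \<in> ?H"
    using f K_subset by (auto simp: inv_BijGroup restrict_inv_into_Bij)
  fix g assume g: "g \<in> ?H"
  have "g \<in> carrier L \<rightarrow> carrier L" using g by (auto dest: Bij_imp_funcset)
  moreover have "compose (carrier L) f g \<in> ring_hom L L"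
    using f g by (auto simp: ring_hom_def compose_def Pi_def)
  moreover have "\<forall>a\<in>K. compose (carrier L) f g a = a"
    using f g K_subset by (auto simp: compose_def)
  ultimately show "f \<otimes>\<^bsub>?B\<^esub> g \<in> ?H"
    using f g by (auto simp: BijGroup_def compose_Bij)
qed

lemma inv_sigma:
  "inv\<^bsub>galois_group L K\<^esub> \<sigma> = (\<lambda>x\<in>carrier L. inv_into (carrier L) \<sigma> x)"
  using group.m_inv_consistent[OF group_BijGroup galois_subgroup, of \<sigma>] sigma_galois
  by (simp add: galois_group_def inv_BijGroup)

lemma fixed_by_generate:
  assumes "\<tau> \<in> generate (galois_group L K) {\<sigma>}" "a \<in> carrier L" "\<sigma> a = a"
  shows "\<tau> a = a"
  using assms(1)
proof (induct rule: generate.induct)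
  case one then show ?case using assms by (simp add: galois_group_def BijGroup_def)
next
  case (incl h) then show ?case using assms by simp
next
  case (inv h)
  then have "h = \<sigma>" by simp
  then show ?case using assms inv_sigma sigma_inj by simp (metis inv_into_f_f)
next
  case (eng f g)
  then have "f \<in> Bij (carrier L)" "g \<in> Bij (carrier L)"
    unfolding generates by (auto simp: galois_group_def)
  then show ?case using eng assms by (simp add: galois_group_def BijGroup_def compose_def)
qed

text \<open>Being fixed by the generator means being fixed by the whole group. All later arguments
  use the Galois condition on the fixed field in this form.\<close>

lemma fixed_imp_K:
  assumes "a \<in> carrier L" "\<sigma> a = a" shows "a \<in> K"
proof -
  have "\<forall>\<tau>\<in>carrier (galois_group L K). \<tau> a = a"
    using fixed_by_generate[OF _ assms] unfolding generates by blast
  then show ?thesis using galois assms by (auto simp: galois_extension_of_degree_def)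
qed

section \<open>Skew polynomials as K-linear operators on L\<close>

text \<open>The coefficients form an arbitrary sequence cut off at \<open>e\<close>, so no support
  condition has to be maintained; that the degree is exactly \<open>e\<close> is expressed by
  \<open>p e \<noteq> \<zero>\<close>.\<close>

abbreviation skew_op :: "nat \<Rightarrow> (nat \<Rightarrow> 'a) \<Rightarrow> 'a \<Rightarrow> 'a" where
  "skew_op e p a \<equiv> (\<Oplus>i\<in>{..e}. p i \<otimes> (\<sigma> ^^ i) a)"

text \<open>Right division with remainder by the operator \<open>\<sigma> - c\<close>. The clause
  \<open>q e = p (Suc e)\<close> keeps track of the leading coefficient, so that the degree drops by
  exactly one.\<close>

lemma skew_op_divide:
  assumes "p \<in> UNIV \<rightarrow> carrier L" "c \<in> carrier L"
  shows "\<exists>q r. q \<in> UNIV \<rightarrow> carrier L \<and> r \<in> carrier L \<and> q e = p (Suc e) \<and>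
    (\<forall>a\<in>carrier L. skew_op (Suc e) p a = skew_op e q (\<sigma> a \<ominus> c \<otimes> a) \<oplus> r \<otimes> a)"
  using assms(1)
proof (induct e arbitrary: p)
  case 0
  have s: "a \<in> carrier L \<Longrightarrow> \<sigma> a \<in> carrier L" for a using funpow_closed[of a 1] by simp
  have p: "p i \<in> carrier L" for i using 0 by auto
  have "p 1 \<otimes> \<sigma> a \<oplus> p 0 \<otimes> a = p 1 \<otimes> (\<sigma> a \<ominus> c \<otimes> a) \<oplus> (p 0 \<oplus> p 1 \<otimes> c) \<otimes> a"
    if "a \<in> carrier L" for a
    using p[of 0] p[of 1] s[OF that] that assms(2) by algebra
  then show ?case using p assms(2) s
    by (intro exI[of _ "\<lambda>_. p 1"] exI[of _ "p 0 \<oplus> p 1 \<otimes> c"]) simp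
next
  case (Suc e)
  have s: "a \<in> carrier L \<Longrightarrow> \<sigma> a \<in> carrier L" for a using funpow_closed[of a 1] by simp
  have p: "p i \<in> carrier L" for i using Suc by auto
  define u where "u = p (Suc (Suc e))"
  define w where "w = (\<sigma> ^^ Suc e) c"
  have uw: "u \<in> carrier L" "w \<in> carrier L" using p funpow_closed[OF assms(2)] unfolding u_def w_def by blast+
  \<comment> \<open>The top term is split as \<open>u \<sigma>^(e+2) = u \<sigma>^(e+1) (\<sigma> -
    c) + u w \<sigma>^(e+1)\<close>; the last summand is added to the coefficient in degree
    \<open>e + 1\<close>.\<close>
  define p' where "p' = p(Suc e := p (Suc e) \<oplus> u \<otimes> w)"
  have p': "p' \<in> UNIV \<rightarrow> carrier L" using p uw by (auto simp: p'_def)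
  obtain q r where q: "q \<in> UNIV \<rightarrow> carrier L" "r \<in> carrier L"
    and qr: "\<And>a. a \<in> carrier L \<Longrightarrow> skew_op (Suc e) p' a = skew_op e q (\<sigma> a \<ominus> c \<otimes> a) \<oplus> r \<otimes> a"
    using Suc.hyps[OF p'] by blast
  define q' where "q' = q(Suc e := u)"
  have "skew_op (Suc (Suc e)) p a = skew_op (Suc e) q' (\<sigma> a \<ominus> c \<otimes> a) \<oplus> r \<otimes> a"
    if a: "a \<in> carrier L" for a
  proof -
    define y where "y = (\<sigma> ^^ Suc e) a"
    define z where "z = (\<sigma> ^^ Suc (Suc e)) a"
    have yz: "y \<in> carrier L" "z \<in> carrier L"
      using funpow_closed[OF a] unfolding y_def z_def by blast+
    have z: "(\<sigma> ^^ Suc e) (\<sigma> a) = z" unfolding z_def by (simp add: funpow_swap1)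
    have d: "(\<sigma> ^^ Suc e) (\<sigma> a \<ominus> c \<otimes> a) = z \<ominus> w \<otimes> y"
      using a assms(2) s unfolding z[symmetric] w_def y_def
      by (simp del: funpow.simps add: funpow_minus)
    define S T where "S = skew_op e p a" and "T = skew_op e q (\<sigma> a \<ominus> c \<otimes> a)"
    have S: "S \<in> carrier L" "T \<in> carrier L" using p q a assms(2) s by (auto simp: S_def T_def Pi_def)
    have S': "skew_op e p' a = S"
      unfolding S_def using p a uw by (intro finsum_cong') (auto simp: p'_def)
    have "skew_op (Suc e) p' a = (p (Suc e) \<oplus> u \<otimes> w) \<otimes> y \<oplus> S"
      using p' a p uw S' by (simp del: funpow.simps add: Pi_def y_def p'_def)
    with qr[OF a] have 1: "(p (Suc e) \<oplus> u \<otimes> w) \<otimes> y \<oplus> S = T \<oplus> r \<otimes> a" by (simp add: T_def)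
    have 2: "skew_op (Suc (Suc e)) p a = u \<otimes> z \<oplus> (p (Suc e) \<otimes> y \<oplus> S)"
      using p a by (simp del: funpow.simps add: Pi_def y_def z_def S_def u_def)
    have T': "skew_op e q' (\<sigma> a \<ominus> c \<otimes> a) = T"
      unfolding T_def using q a uw assms(2) s by (intro finsum_cong') (auto simp: q'_def Pi_def)
    have 3: "skew_op (Suc e) q' (\<sigma> a \<ominus> c \<otimes> a) = u \<otimes> (z \<ominus> w \<otimes> y) \<oplus> T"
      using q a uw assms(2) s T' d by (simp del: funpow.simps add: Pi_def q'_def)
    have "u \<otimes> z \<oplus> (p (Suc e) \<otimes> y \<oplus> S) = u \<otimes> (z \<ominus> w \<otimes> y) \<oplus> ((p (Suc e) \<oplus> u \<otimes> w) \<otimes> y \<oplus> S)"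
      using uw yz p[of "Suc e"] S by algebra
    also have "\<dots> = u \<otimes> (z \<ominus> w \<otimes> y) \<oplus> T \<oplus> r \<otimes> a"
      unfolding 1 using uw yz S q a by algebra
    finally show ?thesis unfolding 2 3 .
  qed
  moreover have "q' \<in> UNIV \<rightarrow> carrier L" "q' (Suc e) = p (Suc (Suc e))"
    using q uw by (auto simp: q'_def u_def)
  ultimately show ?case using q(2) by blast
qed

text \<open>The analogue of the bound on the number of roots of a polynomial. Dividing by an
  operator \<open>\<sigma> - c\<close> that kills the head of the list leaves a quotient of degree
  one less, which kills the images of the tail; these stay independent because the kernel of
  \<open>\<sigma> - c\<close> is only one-dimensional over \<open>K\<close>.\<close>

lemma skew_op_kernel_bound:
  assumes "independent K bs" "p \<in> UNIV \<rightarrow> carrier L" "p e \<noteq> \<zero>"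
    and "\<And>b. b \<in> set bs \<Longrightarrow> skew_op e p b = \<zero>"
  shows "length bs \<le> e"
  using assms
proof (induct e arbitrary: p bs)
  case 0
  show ?case
  proof (cases bs)
    case (Cons b bs')
    have b: "b \<in> carrier L" "b \<notin> Span K bs'" "set bs' \<subseteq> carrier L"
      using 0(1) independent_backwards[of K b bs'] independent_in_carrier[of K bs] Cons by auto
    then have "b \<noteq> \<zero>" using Span_subgroup_props(2)[OF subfield_K b(3)] by blast
    moreover have "p 0 \<otimes> b = \<zero>" using 0(4)[of b] 0(2) b Cons by (simp add: Pi_def)
    ultimately show ?thesis using 0(2,3) b integral[of "p 0" b] by auto
  qed simp
next
  case (Suc e)
  show ?case
  proof (cases bs)
    case (Cons b bs')
    have s: "a \<in> carrier L \<Longrightarrow> \<sigma> a \<in> carrier L" for a using funpow_closed[of a 1] by simp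
    have b: "b \<in> carrier L" "b \<notin> Span K bs'" "set bs' \<subseteq> carrier L" "independent K bs'"
      using Suc(2) independent_backwards[of K b bs'] independent_in_carrier[of K bs] Cons by auto
    then have b0: "b \<noteq> \<zero>" using Span_subgroup_props(2)[OF subfield_K b(3)] by blast
    then have bU: "b \<in> Units L" using b by (simp add: field_Units)
    then have ib: "inv b \<in> carrier L" "inv b \<otimes> b = \<one>" by auto
    \<comment> \<open>With this \<open>c\<close> the operator \<open>D = \<sigma> - c\<close> kills
      \<open>b\<close>. Evaluating the division at \<open>b\<close> then forces the remainder
      \<open>r\<close> to vanish.\<close>
    define c where "c = \<sigma> b \<otimes> inv b"
    have c: "c \<in> carrier L" using ib s b by (simp add: c_def)
    define D where "D = (\<lambda>a. \<sigma> a \<ominus> c \<otimes> a)"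
    have Dc: "a \<in> carrier L \<Longrightarrow> D a \<in> carrier L" for a using c s by (simp add: D_def)
    have cb: "c \<otimes> b = \<sigma> b" using ib s b by (simp add: c_def m_assoc)
    then have Db: "D b = \<zero>" using s b by (simp add: D_def r_neg a_minus_def)
    obtain q r where q: "q \<in> UNIV \<rightarrow> carrier L" "r \<in> carrier L" "q e = p (Suc e)"
      and qr: "\<And>a. a \<in> carrier L \<Longrightarrow> skew_op (Suc e) p a = skew_op e q (D a) \<oplus> r \<otimes> a"
      using skew_op_divide[OF Suc(3) c, of e] unfolding D_def by blast
    have "skew_op e q \<zero> = \<zero>" using q by (simp add: Pi_def)
    then have "r \<otimes> b = \<zero>"
      using qr[OF b(1)] Suc(5)[of b] Cons Db q b by simp
    then have r0: "r = \<zero>" using b0 q b integral[of r b] by auto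
    have combD: "combine Ks (map D us) = D (combine Ks us)"
      if "set Ks \<subseteq> K" "set us \<subseteq> carrier L" for Ks us
      using that
    proof (induct Ks us rule: combine.induct)
      case (1 k Ks u us)
      have cc: "combine Ks us \<in> carrier L" "k \<in> carrier L" "u \<in> carrier L"
        using 1 K_subset by auto
      have "\<sigma> (k \<otimes> u \<oplus> combine Ks us) = k \<otimes> \<sigma> u \<oplus> \<sigma> (combine Ks us)"
        using cc funpow_plus[of "k \<otimes> u" "combine Ks us" 1] funpow_mul[of k u 1] sigma_fixes_K[of k] 1 by simp
      then have "D (combine (k # Ks) (u # us)) =
          k \<otimes> \<sigma> u \<oplus> \<sigma> (combine Ks us) \<ominus> c \<otimes> (k \<otimes> u \<oplus> combine Ks us)" by (simp add: D_def)
      also have "\<dots> = k \<otimes> D u \<oplus> D (combine Ks us)"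
        unfolding D_def using cc c s[OF cc(3)] s[OF cc(1)] by algebra
      finally show ?case using 1 by simp
    next
      case ("2_1" us)
      then show ?case using c funpow_zero[of 1] by (simp add: D_def a_minus_def)
    next
      case ("2_2" Ks)
      then show ?case using c funpow_zero[of 1] by (simp add: D_def a_minus_def)
    qed
    have "independent K (map D bs')"
    proof (rule trivial_combine_imp_independent[OF subfield_K])
      show "set (map D bs') \<subseteq> carrier L" using b Dc by auto
      fix Ks assume Ks: "set Ks \<subseteq> K" and "combine Ks (map D bs') = \<zero>"
      define v where "v = combine Ks bs'"
      have v: "v \<in> carrier L" using Ks K_subset b by (auto simp: v_def)
      have "D v = \<zero>" using combD[OF Ks b(3)] \<open>combine Ks (map D bs') = \<zero>\<close> by (simp add: v_def)
      then have sv: "\<sigma> v = c \<otimes> v" using v s c by (simp add: D_def)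
      \<comment> \<open>\<open>\<sigma> v = c \<otimes> v\<close> says that \<open>v / b\<close> is
        fixed by \<open>\<sigma>\<close>, hence in \<open>K\<close>: the kernel of \<open>D\<close>
        is \<open>K b\<close>. A relation among the images under \<open>D\<close> therefore extends,
        by the coefficient \<open>\<ominus> k\<close> at \<open>b\<close>, to a relation among
        \<open>b # bs'\<close>.\<close>
      define k where "k = v \<otimes> inv b"
      have k: "k \<in> carrier L" using v ib by (simp add: k_def)
      have kb: "k \<otimes> b = v" using v ib b by (simp add: k_def m_assoc)
      have "\<sigma> k \<otimes> \<sigma> b = c \<otimes> v" using kb sv funpow_mul[OF k b(1), of 1] by simp
      also have "\<dots> = k \<otimes> (c \<otimes> b)" unfolding kb[symmetric] using c k b by (simp add: m_lcomm)
      also have "\<dots> = k \<otimes> \<sigma> b" unfolding cb ..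
      finally have "\<sigma> k = k"
        using m_rcancel[of "\<sigma> b" "\<sigma> k" k] s k b b0 funpow_eq_zero_iff[of b 1] by simp
      then have kK: "k \<in> K" using k by (rule fixed_imp_K[rotated])
      then have mk: "\<ominus> k \<in> K" using subringE(5)[OF subfieldE(1)[OF subfield_K]] by auto
      have "combine (\<ominus> k # Ks) (b # bs') = \<zero>"
        using k b v kb by (simp add: v_def[symmetric] l_minus l_neg)
      then have "set (take (length (b # bs')) (\<ominus> k # Ks)) \<subseteq> {\<zero>}"
        using independent_imp_trivial_combine[OF subfield_K, of "b # bs'" "\<ominus> k # Ks"] Suc(2) Cons Ks mk by auto
      then show "set (take (length (map D bs')) Ks) \<subseteq> {\<zero>}" by auto
    qed
    moreover have "skew_op e q d = \<zero>" if d: "d \<in> set (map D bs')" for d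
    proof -
      obtain a where a: "a \<in> set bs'" "d = D a" using d by auto
      then have ac: "a \<in> carrier L" using b by auto
      have "skew_op e q d \<in> carrier L" using q Dc[OF ac] a by (auto simp: Pi_def)
      then show ?thesis using qr[OF ac] Suc(5)[of a] Cons a r0 ac by simp
    qed
    ultimately have "length (map D bs') \<le> e"
      using Suc(4) unfolding q(3)[symmetric] by (intro Suc(1)[OF _ q(1)])
    then show ?thesis using Cons by simp
  qed simp
qed


section \<open>Lower bound for the order of \<sigma>\<close>

lemma n_pos: "n > 0"
proof (rule ccontr)
  assume "\<not> n > 0"
  then have "carrier L = {\<zero>}" using dimension_zero[OF subfield_K] dim_K by simp
  then show False using one_closed one_not_zero by auto
qed

text \<open>Otherwise \<open>\<sigma>^j - 1\<close>, an operator of degree \<open>j\<close>, would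
  kill a \<open>K\<close>-basis of \<open>L\<close> with more than \<open>j\<close>
  elements.\<close>

lemma funpow_eq_id_imp_le:
  assumes "0 < j" "\<And>a. a \<in> carrier L \<Longrightarrow> (\<sigma> ^^ j) a = a"
  shows "n \<le> j"
proof -
  obtain bs where bs: "set bs \<subseteq> carrier L" "independent K bs" "length bs = n"
    using exists_base[OF subfield_K dim_K] by blast
  define p where "p = (\<lambda>i::nat. if i = 0 then \<ominus> \<one> else if i = j then \<one> else \<zero>)"
  have p: "p \<in> UNIV \<rightarrow> carrier L" by (auto simp: p_def)
  have "length bs \<le> j"
  proof (rule skew_op_kernel_bound[OF bs(2) p])
    show "p j \<noteq> \<zero>" using assms(1) by (simp add: p_def)
    fix b assume "b \<in> set bs"
    then have b: "b \<in> carrier L" using bs by auto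
    obtain j' where j': "j = Suc j'" using assms(1) gr0_conv_Suc by auto
    have "skew_op j' p b = p 0 \<otimes> (\<sigma> ^^ 0) b"
      using b p j' by (intro finsum_only) (auto simp: p_def)
    then have z: "skew_op j' p b = \<ominus> b" using b by (simp add: p_def l_minus)
    have "p j \<otimes> (\<sigma> ^^ j) b = b" using assms b by (simp add: p_def)
    then have "skew_op j p b = b \<oplus> skew_op j' p b"
      using b p unfolding j' by (subst finsum_Suc) (auto simp: Pi_def)
    then show "skew_op j p b = \<zero>" using z b by (simp add: r_neg)
  qed
  then show ?thesis using bs by simp
qed

section \<open>Annihilating operators of subspaces\<close>

lemma skew_op_closed [simp]:
  "\<lbrakk>p \<in> UNIV \<rightarrow> carrier L; a \<in> carrier L\<rbrakk> \<Longrightarrow> skew_op e p a \<in> carrier L"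
  by (auto simp: Pi_def)

lemma skew_op_add:
  assumes "p \<in> UNIV \<rightarrow> carrier L" "a \<in> carrier L" "b \<in> carrier L"
  shows "skew_op e p (a \<oplus> b) = skew_op e p a \<oplus> skew_op e p b"
  using assms by (simp add: Pi_def r_distr finsum_addf)

lemma skew_op_scale:
  assumes "p \<in> UNIV \<rightarrow> carrier L" "k \<in> K" "b \<in> carrier L"
  shows "skew_op e p (k \<otimes> b) = k \<otimes> skew_op e p b"
proof -
  have k: "k \<in> carrier L" using assms K_subset by auto
  have "skew_op e p (k \<otimes> b) = (\<Oplus>i\<in>{..e}. k \<otimes> (p i \<otimes> (\<sigma> ^^ i) b))"
    using assms k funpow_fixes[OF sigma_fixes_K[OF assms(2)]]
    by (intro finsum_cong') (auto simp: Pi_def m_lcomm)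
  also have "\<dots> = k \<otimes> skew_op e p b"
    using assms k by (subst finsum_rdistr) (auto simp: Pi_def)
  finally show ?thesis .
qed

text \<open>The coefficients displayed are those of \<open>\<sigma> - d\<close> composed on the left
  with the operator of \<open>p\<close>. The test \<open>i \<le> e\<close> truncates
  \<open>p\<close>, whose values above \<open>e\<close> are arbitrary.\<close>

lemma skew_op_compose_linear:
  assumes p: "p \<in> UNIV \<rightarrow> carrier L" and d: "d \<in> carrier L" and a: "a \<in> carrier L"
  shows "skew_op (Suc e) (\<lambda>i. (if i = 0 then \<zero> else \<sigma> (p (i - 1))) \<ominus> d \<otimes> (if i \<le> e then p i else \<zero>)) a
    = \<sigma> (skew_op e p a) \<ominus> d \<otimes> skew_op e p a"
proof -
  have pc: "p i \<in> carrier L" for i using p by auto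
  have s: "x \<in> carrier L \<Longrightarrow> \<sigma> x \<in> carrier L" for x using funpow_closed[of x 1] by simp
  define u where "u = (\<lambda>i. (if i = 0 then \<zero> else \<sigma> (p (i - 1))))"
  define w where "w = (\<lambda>i. \<ominus> d \<otimes> (if i \<le> e then p i else \<zero>))"
  have uw: "u i \<in> carrier L" "w i \<in> carrier L" for i using pc s d by (auto simp: u_def w_def)
  have c: "(\<sigma> ^^ i) a \<in> carrier L" for i using a by simp
  have "skew_op (Suc e) (\<lambda>i. (if i = 0 then \<zero> else \<sigma> (p (i - 1))) \<ominus> d \<otimes> (if i \<le> e then p i else \<zero>)) a
    = (\<Oplus>i\<in>{..Suc e}. u i \<otimes> (\<sigma> ^^ i) a \<oplus> w i \<otimes> (\<sigma> ^^ i) a)"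
    using uw c d pc s by (intro finsum_cong') (auto simp: u_def w_def l_distr a_minus_def l_minus simp del: funpow.simps)
  also have "\<dots> = (\<Oplus>i\<in>{..Suc e}. u i \<otimes> (\<sigma> ^^ i) a) \<oplus> (\<Oplus>i\<in>{..Suc e}. w i \<otimes> (\<sigma> ^^ i) a)"
    using uw c by (intro finsum_addf) (auto simp del: funpow.simps)
  also have "(\<Oplus>i\<in>{..Suc e}. u i \<otimes> (\<sigma> ^^ i) a) = (\<Oplus>i\<in>{..e}. u (Suc i) \<otimes> (\<sigma> ^^ Suc i) a) \<oplus> u 0 \<otimes> (\<sigma> ^^ 0) a"
    using uw c by (subst finsum_Suc2) (auto simp del: funpow.simps)
  also have "u 0 \<otimes> (\<sigma> ^^ 0) a = \<zero>" using a by (simp add: u_def)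
  also have "(\<Oplus>i\<in>{..e}. u (Suc i) \<otimes> (\<sigma> ^^ Suc i) a) = (\<Oplus>i\<in>{..e}. (\<sigma> ^^ 1) (p i \<otimes> (\<sigma> ^^ i) a))"
    using pc c s by (intro finsum_cong') (auto simp: u_def ring_hom_mult[OF sigma_hom])
  also have "\<dots> = \<sigma> (skew_op e p a)"
    using pc c by (subst funpow_finsum[symmetric]) auto
  also have "(\<Oplus>i\<in>{..Suc e}. w i \<otimes> (\<sigma> ^^ i) a) = w (Suc e) \<otimes> (\<sigma> ^^ Suc e) a \<oplus> (\<Oplus>i\<in>{..e}. w i \<otimes> (\<sigma> ^^ i) a)"
    using uw c by (subst finsum_Suc) (auto simp del: funpow.simps)
  also have "w (Suc e) \<otimes> (\<sigma> ^^ Suc e) a = \<zero>" using c d s by (simp add: w_def)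
  also have "(\<Oplus>i\<in>{..e}. w i \<otimes> (\<sigma> ^^ i) a) = (\<Oplus>i\<in>{..e}. (\<ominus> d) \<otimes> (p i \<otimes> (\<sigma> ^^ i) a))"
    using pc c d by (intro finsum_cong') (auto simp: w_def m_assoc l_minus)
  also have "\<dots> = (\<ominus> d) \<otimes> skew_op e p a"
    using pc c d by (subst finsum_rdistr) auto
  finally show ?thesis using d s skew_op_closed[OF p a, of e] by (simp add: a_minus_def l_minus)
qed

text \<open>An annihilator is built one dimension at a time. If the one for \<open>E\<close> does
  not kill the new vector \<open>v\<close>, it maps the extended space into the line
  \<open>K c\<close> with \<open>c = skew_op e p v\<close>, and a further factor of degree one kills
  this line.\<close>

lemma exists_annihilator:
  assumes "dimension u K E"
  shows "\<exists>e p. e \<le> u \<and> p \<in> UNIV \<rightarrow> carrier L \<and> p e \<noteq> \<zero> \<and> (\<forall>b\<in>E. skew_op e p b = \<zero>)"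
proof -
  \<comment> \<open>The scalar field is a varying argument of \<open>dimension.induct\<close>, so it
    is renamed and tied to \<open>K\<close> by an equation.\<close>
  have "dimension u K' E \<Longrightarrow> K' = K \<Longrightarrow> ?thesis" for K'
  proof (induct u K' E rule: dimension.induct)
    case (zero_dim K')
    show ?case by (intro exI[of _ 0] exI[of _ "\<lambda>_. \<one>"]) auto
  next
    case (Suc_dim v E u K')
    have EL: "E \<subseteq> carrier L" using space_subgroup_props(1)[OF subfield_K] Suc_dim by blast
    obtain e p where e: "e \<le> u" and p: "p \<in> UNIV \<rightarrow> carrier L" "p e \<noteq> \<zero>"
      and kill: "\<And>b. b \<in> E \<Longrightarrow> skew_op e p b = \<zero>"
      using Suc_dim by blast
    have s: "x \<in> carrier L \<Longrightarrow> \<sigma> x \<in> carrier L" for x using funpow_closed[of x 1] by simp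
    define c where "c = skew_op e p v"
    have v: "v \<in> carrier L" by fact
    have c: "c \<in> carrier L" unfolding c_def using p v by simp
    have ext: "\<exists>k x. k \<in> K \<and> k \<in> carrier L \<and> x \<in> carrier L \<and> b = k \<otimes> v \<oplus> x \<and> skew_op e p b = k \<otimes> c"
      if bE: "b \<in> line_extension K' v E" for b
    proof -
      obtain k x where kx: "k \<in> K" "x \<in> E" "b = k \<otimes> v \<oplus> x"
        using bE line_extension_mem_iff[of b K v E] Suc_dim.prems by blast
      then have kc: "k \<in> carrier L" "x \<in> carrier L" using K_subset EL by auto
      have "skew_op e p b = k \<otimes> c"
      proof -
        have 1: "skew_op e p (k \<otimes> v \<oplus> x) = skew_op e p (k \<otimes> v) \<oplus> skew_op e p x"
          by (rule skew_op_add) (use p kc v in auto)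
        have 2: "skew_op e p (k \<otimes> v) = k \<otimes> skew_op e p v"
          by (rule skew_op_scale) (use p kx v in auto)
        show ?thesis unfolding kx(3) 1 2 kill[OF kx(2)] c_def[symmetric] using kc c by simp
      qed
      then show ?thesis using kx kc by blast
    qed
    show ?case
    proof (cases "c = \<zero>")
      case True
      have "skew_op e p b = \<zero>" if b: "b \<in> line_extension K' v E" for b
        using ext[OF b] True by auto
      then show ?thesis using e p by (intro exI[of _ e] exI[of _ p]) auto
    next
      case False
      then have "c \<in> Units L" using c by (simp add: field_Units)
      then have ic: "inv c \<in> carrier L" "inv c \<otimes> c = \<one>" by auto
      \<comment> \<open>Chosen so that \<open>\<sigma> - d\<close> kills \<open>c\<close>, and with
        it every \<open>K\<close>-multiple of \<open>c\<close>.\<close>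
      define d where "d = \<sigma> c \<otimes> inv c"
      have d: "d \<in> carrier L" "d \<otimes> c = \<sigma> c" using ic c s by (auto simp: d_def m_assoc)
      define p' where "p' = (\<lambda>i. (if i = 0 then \<zero> else \<sigma> (p (i - 1))) \<ominus> d \<otimes> (if i \<le> e then p i else \<zero>))"
      have pc: "p i \<in> carrier L" for i using p by auto
      have p': "p' \<in> UNIV \<rightarrow> carrier L" using pc s d by (auto simp: p'_def)
      have "p' (Suc e) \<noteq> \<zero>"
        using pc[of e] s d p(2) funpow_eq_zero_iff[of "p e" 1] by (simp add: p'_def a_minus_def)
      moreover have "skew_op (Suc e) p' b = \<zero>" if b: "b \<in> line_extension K' v E" for b
      proof -
        obtain k x where kx: "k \<in> K" "k \<in> carrier L" "x \<in> carrier L" "b = k \<otimes> v \<oplus> x" "skew_op e p b = k \<otimes> c"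
          using ext[OF b] by blast
        then have bL: "b \<in> carrier L" using v by simp
        have "\<sigma> (k \<otimes> c) = k \<otimes> \<sigma> c"
          using kx c by (simp add: ring_hom_mult[OF sigma_hom] sigma_fixes_K)
        moreover have "d \<otimes> (k \<otimes> c) = k \<otimes> \<sigma> c"
          using kx c d m_lcomm[of d k c] by simp
        ultimately show ?thesis
          unfolding p'_def skew_op_compose_linear[OF p(1) d(1) bL] kx(5)
          using kx c s by (simp add: r_neg a_minus_def)
      qed
      ultimately show ?thesis using e p' by (intro exI[of _ "Suc e"] exI[of _ p']) auto
    qed
  qed
  then show ?thesis using assms by blast
qed

section \<open>The exact order of \<sigma> and the intermediate field\<close>

text \<open>Dedekind's argument: take an operator of least degree \<open>e\<close> that kills
  \<open>S\<close>. Substituting \<open>b \<otimes> x\<close> for \<open>x\<close>, which closure of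
  \<open>S\<close> under products allows, and eliminating the top term would give a smaller one
  unless \<open>\<sigma> ^^ i\<close> and \<open>\<sigma> ^^ e\<close> agree on \<open>S\<close> for
  each \<open>i\<close> with \<open>p i \<noteq> \<zero>\<close>. Then \<open>j = e - i\<close>
  works by injectivity.\<close>

lemma exists_funpow_eq_id_on:
  assumes dim: "dimension u K S" and one: "\<one> \<in> S"
    and mult: "\<And>a b. a \<in> S \<Longrightarrow> b \<in> S \<Longrightarrow> a \<otimes> b \<in> S"
  shows "\<exists>j. 0 < j \<and> j \<le> u \<and> (\<forall>a\<in>S. (\<sigma> ^^ j) a = a)"
proof -
  have SL: "S \<subseteq> carrier L" using space_subgroup_props(1)[OF subfield_K dim] .
  define P where "P = (\<lambda>e. \<exists>p. p \<in> UNIV \<rightarrow> carrier L \<and> p e \<noteq> \<zero> \<and> (\<forall>b\<in>S. skew_op e p b = \<zero>))"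
  obtain e0 where e0: "e0 \<le> u" "P e0" using exists_annihilator[OF dim] unfolding P_def by blast
  define e where "e = (LEAST e. P e)"
  have Pe: "P e" unfolding e_def using e0(2) by (rule LeastI)
  have eu: "e \<le> u" using Least_le[of P, OF e0(2)] e0 by (simp add: e_def)
  have least: "\<not> P i" if "i < e" for i using not_less_Least that unfolding e_def by blast
  obtain p where p: "p \<in> UNIV \<rightarrow> carrier L" "p e \<noteq> \<zero>" and kill: "\<And>b. b \<in> S \<Longrightarrow> skew_op e p b = \<zero>"
    using Pe unfolding P_def by blast
  have pc: "p i \<in> carrier L" for i using p by auto
  \<comment> \<open>A single term \<open>p e \<sigma>^e\<close> cannot kill
    \<open>\<one> \<in> S\<close>.\<close>
  have "\<exists>i<e. p i \<noteq> \<zero>"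
  proof (rule ccontr)
    assume "\<not> ?thesis"
    then have "skew_op e p \<one> = p e \<otimes> (\<sigma> ^^ e) \<one>"
      using pc by (intro finsum_only) auto
    then show False using kill[OF one] p(2) pc by simp
  qed
  then obtain i where i: "i < e" "p i \<noteq> \<zero>" by blast
  have "(\<sigma> ^^ i) b = (\<sigma> ^^ e) b" if b: "b \<in> S" for b
  proof (rule ccontr)
    assume ne: "(\<sigma> ^^ i) b \<noteq> (\<sigma> ^^ e) b"
    have bL: "b \<in> carrier L" using b SL by auto
    \<comment> \<open>The coefficients of \<open>x \<mapsto> p(b x) - \<sigma>^e(b) p(x)\<close>:
      this operator still kills \<open>S\<close>, but its coefficient in degree \<open>e\<close>
      vanishes while the one in degree \<open>i\<close> does not.\<close>
    define q where "q = (\<lambda>i. p i \<otimes> ((\<sigma> ^^ i) b \<ominus> (\<sigma> ^^ e) b))"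
    have qc: "q i \<in> carrier L" for i using pc bL by (simp add: q_def)
    have qi: "q i \<noteq> \<zero>"
      using ne i pc bL integral[of "p i" "(\<sigma> ^^ i) b \<ominus> (\<sigma> ^^ e) b"] by (auto simp: q_def)
    have qe: "q e = \<zero>" using pc bL by (simp add: q_def a_minus_def r_neg)
    have qkill: "skew_op e q x = \<zero>" if x: "x \<in> S" for x
    proof -
      have xL: "x \<in> carrier L" using x SL by auto
      have "skew_op e q x = (\<Oplus>i\<in>{..e}. p i \<otimes> (\<sigma> ^^ i) (b \<otimes> x) \<oplus> (\<ominus> (\<sigma> ^^ e) b) \<otimes> (p i \<otimes> (\<sigma> ^^ i) x))"
      proof (intro finsum_cong')
        fix i
        have "(\<sigma> ^^ i) b \<in> carrier L" "(\<sigma> ^^ e) b \<in> carrier L" "(\<sigma> ^^ i) x \<in> carrier L" "p i \<in> carrier L"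
          using bL xL pc by auto
        then have "p i \<otimes> ((\<sigma> ^^ i) b \<ominus> (\<sigma> ^^ e) b) \<otimes> (\<sigma> ^^ i) x
          = p i \<otimes> ((\<sigma> ^^ i) b \<otimes> (\<sigma> ^^ i) x) \<oplus> (\<ominus> (\<sigma> ^^ e) b) \<otimes> (p i \<otimes> (\<sigma> ^^ i) x)"
          by algebra
        then show "q i \<otimes> (\<sigma> ^^ i) x = p i \<otimes> (\<sigma> ^^ i) (b \<otimes> x) \<oplus> (\<ominus> (\<sigma> ^^ e) b) \<otimes> (p i \<otimes> (\<sigma> ^^ i) x)"
          using bL xL by (simp add: q_def)
      qed (use pc bL xL in auto)
      also have "\<dots> = skew_op e p (b \<otimes> x) \<oplus> (\<ominus> (\<sigma> ^^ e) b) \<otimes> skew_op e p x"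
        using pc bL xL by (subst finsum_addf) (auto simp: finsum_rdistr)
      also have "\<dots> = \<zero>" using kill[OF x] kill[OF mult[OF b x]] bL by simp
      finally show ?thesis .
    qed
    \<comment> \<open>Further top coefficients of \<open>q\<close> may vanish, so its true degree
      has to be found before minimality can be contradicted.\<close>
    define m where "m = Max {i. i < e \<and> q i \<noteq> \<zero>}"
    have "m \<in> {i. i < e \<and> q i \<noteq> \<zero>}"
      unfolding m_def using i qi by (intro Max_in) auto
    then have m: "m < e" "q m \<noteq> \<zero>" by auto
    have above: "q i = \<zero>" if "m < i" "i \<le> e" for i
      using Max_ge[of "{i. i < e \<and> q i \<noteq> \<zero>}" i] that qe unfolding m_def[symmetric]
      by (cases "i = e") auto
    have "skew_op m q x = \<zero>" if x: "x \<in> S" for x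
    proof -
      have xL: "x \<in> carrier L" using x SL by auto
      have "skew_op m q x = skew_op e q x"
        using m xL qc above by (intro add.finprod_mono_neutral_cong_left) auto
      then show ?thesis using qkill[OF x] by simp
    qed
    then have "P m" unfolding P_def using m(2) qc by (intro exI[of _ q]) auto
    then show False using least m(1) by blast
  qed
  then have "(\<sigma> ^^ i) ((\<sigma> ^^ (e - i)) b) = (\<sigma> ^^ i) b" if "b \<in> S" for b
    using that i by (simp add: funpow_funpow)
  then have "(\<sigma> ^^ (e - i)) b = b" if "b \<in> S" for b
    using inj_onD[OF funpow_inj[of i], of "(\<sigma> ^^ (e - i)) b" b] that SL by auto
  then show ?thesis using i eu by (intro exI[of _ "e - i"]) auto
qed

text \<open>For \<open>S = L\<close> the two bounds meet: some \<open>j \<le> n\<close> gives the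
  identity, and no positive \<open>j < n\<close> does.\<close>

lemma funpow_n: "a \<in> carrier L \<Longrightarrow> (\<sigma> ^^ n) a = a"
proof -
  obtain j where j: "0 < j" "j \<le> n" "\<And>a. a \<in> carrier L \<Longrightarrow> (\<sigma> ^^ j) a = a"
    using exists_funpow_eq_id_on[OF dim_K] by auto
  moreover have "n \<le> j" using funpow_eq_id_imp_le j by blast
  ultimately show "a \<in> carrier L \<Longrightarrow> ?thesis" by simp
qed

lemma funpow_n_mult: "a \<in> carrier L \<Longrightarrow> (\<sigma> ^^ (n * i)) a = a"
  by (induct i) (simp_all add: funpow_funpow[symmetric] funpow_n)

lemma funpow_eq_id_imp_dvd:
  assumes "\<And>a. a \<in> carrier L \<Longrightarrow> (\<sigma> ^^ j) a = a"
  shows "n dvd j"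
proof -
  have "(\<sigma> ^^ (j mod n)) a = a" if a: "a \<in> carrier L" for a
  proof -
    have "(\<sigma> ^^ (j mod n)) ((\<sigma> ^^ (n * (j div n))) a) = a"
      using assms[OF a] by (simp only: funpow_funpow mod_mult_div_eq)
    then show ?thesis using a by (simp add: funpow_n_mult)
  qed
  then have "\<not> 0 < j mod n"
    using funpow_eq_id_imp_le[of "j mod n"] mod_less_divisor[OF n_pos, of j] by auto
  then show ?thesis by auto
qed

text \<open>A power of \<open>\<sigma>\<close> other than the identity fixes the intermediate field pointwise, since
  \<open>1, \<sigma>, \<dots>\<close> are dependent on it already in degree less than \<open>n\<close>; by degree reasons the
  intermediate field is all of the fixed field of that power.\<close>

lemma intermediate_field_invariant:
  assumes E: "subfield E L" and KE: "K \<subseteq> E" and dim: "dimension 2 E (carrier L)" and a: "a \<in> E"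
  shows "(\<sigma> ^^ i) a \<in> E"
proof -
  have EL: "E \<subseteq> carrier L" using subfieldE(3)[OF E] .
  have one: "\<one> \<in> E" using subringE(3)[OF subfieldE(1)[OF E]] .
  have mult: "\<And>a b. a \<in> E \<Longrightarrow> b \<in> E \<Longrightarrow> a \<otimes> b \<in> E" using subringE(6)[OF subfieldE(1)[OF E]] .
  have "subalgebra K E L"
    using subring.axioms(1)[OF subfieldE(1)[OF E]] KE mult
    by (auto simp: subalgebra_def subalgebra_axioms_def)
  then obtain u where u: "dimension u K E"
    using subalbegra_incl_imp_finite_dimension[OF subfield_K finite_dimensionI[OF dim_K] _ EL] by blast
  have "dimension (u * 2) K (carrier L)" using telescopic_base[OF subfield_K E u dim] .
  then have "u * 2 = n" using dimension_is_inj[OF subfield_K _ dim_K] by blast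
  then have un: "u < n" using n_pos by simp
  obtain j where j: "0 < j" "j \<le> u" "\<And>a. a \<in> E \<Longrightarrow> (\<sigma> ^^ j) a = a"
    using exists_funpow_eq_id_on[OF u one mult] by blast
  \<comment> \<open>Over \<open>E\<close> the field \<open>L\<close> has dimension 2, so a fixed
    \<open>x\<close> outside \<open>E\<close> would form a basis together with
    \<open>\<one>\<close>, and \<open>\<sigma> ^^ j\<close> would be the identity on all of
    \<open>L\<close> although \<open>j < n\<close>.\<close>
  have "x \<in> E" if x: "x \<in> carrier L" "(\<sigma> ^^ j) x = x" for x
  proof (rule ccontr)
    assume xE: "x \<notin> E"
    have SE: "Span E [\<one>] = E"
      using EL one line_extension_mem_iff[of _ E \<one> "{\<zero>}"] subsetD[OF EL] by auto
    have "independent E [x, \<one>]"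
      using x xE SE by (intro li_Cons) auto
    then have "Span E [x, \<one>] = carrier L"
      using independent_length_eq_dimension[OF E dim, of "[x, \<one>]"] x by (simp del: Span.simps)
    then have S: "carrier L = line_extension E x E" using SE by simp
    have "(\<sigma> ^^ j) y = y" if "y \<in> carrier L" for y
    proof -
      have "y \<in> line_extension E x E" using that S by simp
      then obtain k v where kv: "k \<in> E" "v \<in> E" "y = k \<otimes> x \<oplus> v"
        unfolding line_extension_mem_iff by blast
      then have "k \<in> carrier L" "v \<in> carrier L" using EL by auto
      then show ?thesis using kv j(3) x by simp
    qed
    then have "n \<le> j" using funpow_eq_id_imp_le j(1) by blast
    then show False using j(2) un by simp
  qed
  \<comment> \<open>Powers of \<open>\<sigma>\<close> commute, hence each of them preserves the
    fixed field of \<open>\<sigma> ^^ j\<close>.\<close>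
  moreover have "(\<sigma> ^^ j) ((\<sigma> ^^ i) a) = (\<sigma> ^^ i) a"
    using j(3)[OF a] by (metis funpow_funpow add.commute)
  ultimately show ?thesis using a EL by auto
qed

lemma intermediate_field_proper:
  assumes E: "subfield E L" and dim: "dimension 2 E (carrier L)"
  shows "\<exists>x\<in>carrier L. x \<notin> E"
proof (rule ccontr)
  assume "\<not> ?thesis"
  then have "E = carrier L" using subfieldE(3)[OF E] by auto
  then have "(2::nat) = 1" using dimension_is_inj[OF E dim] dimension_one[OF E] by simp
  then show False by simp
qed

end

section \<open>The quotient by a central polynomial\<close>

context cyclic_galois
begin

section \<open>The substitution of x^n into polynomials over K\<close>

abbreviation Ky where "Ky \<equiv> UP (subring_on L K)"

text \<open>A closed form for the coefficients of \<open>p(x^n)\<close>;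
  \<open>eval_at_xn_eq\<close> identifies it with the evaluation homomorphism.\<close>

definition in_xn :: "(nat \<Rightarrow> 'a) \<Rightarrow> nat \<Rightarrow> 'a" where
  "in_xn p = (\<lambda>i. if n dvd i then p (i div n) else \<zero>)"

lemma ring_LK: "ring (subring_on L K)" and field_LK: "field (subring_on L K)"
  using subfield_iff(2)[OF subfield_K] by (auto intro: field.is_ring)

lemma K_closed [simp]:
  shows "\<zero> \<in> K" "\<one> \<in> K"
    and "a \<in> K \<Longrightarrow> \<ominus> a \<in> K"
    and "a \<in> K \<Longrightarrow> b \<in> K \<Longrightarrow> a \<otimes> b \<in> K"
    and "a \<in> K \<Longrightarrow> b \<in> K \<Longrightarrow> a \<oplus> b \<in> K"
  using subringE[OF subfieldE(1)[OF subfield_K]] by auto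

lemma K_mem_L: "a \<in> K \<Longrightarrow> a \<in> carrier L" using K_subset by auto

lemma funpow_K [simp]: "a \<in> K \<Longrightarrow> (\<sigma> ^^ i) a = a"
  by (rule funpow_fixes) (rule sigma_fixes_K)

lemma carrier_Ky: "p \<in> carrier Ky \<longleftrightarrow> (\<forall>i. p i \<in> K) \<and> (\<exists>N. \<forall>i>N. p i = \<zero>)"
  by (auto simp: UP_def up_def bound_def)

lemma Ky_memE:
  assumes "p \<in> carrier Ky" obtains N where "\<And>i. p i \<in> K" "\<And>i. N < i \<Longrightarrow> p i = \<zero>"
  using assms carrier_Ky by blast

lemma in_xn_K: "(\<And>i. p i \<in> K) \<Longrightarrow> in_xn p i \<in> K" by (simp add: in_xn_def)

lemma in_xn_mult_n: "in_xn p (n * i) = p i" using n_pos by (simp add: in_xn_def)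

lemma in_xn_closed:
  assumes "p \<in> carrier Ky" shows "in_xn p \<in> carrier R"
proof -
  obtain N where N: "\<And>i. p i \<in> K" "\<And>i. N < i \<Longrightarrow> p i = \<zero>" using Ky_memE[OF assms] by blast
  show ?thesis
  proof (rule R_memI[of _ "n * Suc N"])
    show "in_xn p i \<in> carrier L" for i using in_xn_K[of p] N K_mem_L by blast
    show "in_xn p i = \<zero>" if "n * Suc N \<le> i" for i
    proof -
      have "Suc N \<le> i div n" using that n_pos by (simp add: less_eq_div_iff_mult_less_eq mult.commute)
      then show ?thesis using N by (simp add: in_xn_def)
    qed
  qed
qed

lemma finsum_atMost_rev:
  assumes "f \<in> {..N} \<rightarrow> carrier L"
  shows "(\<Oplus>i\<in>{..N::nat}. f (N - i)) = (\<Oplus>i\<in>{..N}. f i)"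
proof -
  have image: "(\<lambda>i. N - i) ` {..N} = {..N}"
  proof
    show "{..N} \<subseteq> (\<lambda>i. N - i) ` {..N}"
    proof
      fix i assume "i \<in> {..N}"
      then show "i \<in> (\<lambda>i. N - i) ` {..N}" by (intro image_eqI[of _ _ "N - i"]) auto
    qed
  qed auto
  have "finsum L f ((\<lambda>i. N - i) ` {..N}) = (\<Oplus>i\<in>{..N}. f (N - i))"
    using assms by (intro add.finprod_reindex) (auto intro!: inj_onI)
  then show ?thesis unfolding image by (rule sym)
qed

text \<open>\<open>x^n\<close> commutes with \<open>L\<close> because \<open>\<sigma>^n\<close> is
  the identity, and \<open>K\<close> commutes with \<open>x\<close> because \<open>\<sigma>\<close>
  fixes it. The two products list their terms in opposite order, hence the reversal of one
  sum.\<close>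

lemma in_xn_central:
  assumes "p \<in> carrier Ky" "q \<in> carrier R"
  shows "in_xn p \<otimes>\<^bsub>R\<^esub> q = q \<otimes>\<^bsub>R\<^esub> in_xn p"
proof
  fix N
  have P: "in_xn p i \<in> K" for i using in_xn_K assms(1) carrier_Ky by blast
  have PL: "in_xn p i \<in> carrier L" for i using P K_mem_L by blast
  have "(q \<otimes>\<^bsub>R\<^esub> in_xn p) N = (\<Oplus>i\<in>{..N}. q i \<otimes> in_xn p (N - i))"
    using assms P by (simp add: mult_apply in_xn_closed)
  also have "\<dots> = (\<Oplus>i\<in>{..N}. q (N - i) \<otimes> in_xn p i)"
  proof -
    have "(\<Oplus>i\<in>{..N}. q i \<otimes> in_xn p (N - i)) = (\<Oplus>i\<in>{..N}. q (N - (N - i)) \<otimes> in_xn p (N - i))"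
      using assms PL by (intro finsum_cong') auto
    also have "\<dots> = (\<Oplus>i\<in>{..N}. q (N - i) \<otimes> in_xn p i)"
      using assms PL by (intro finsum_atMost_rev[of "\<lambda>i. q (N - i) \<otimes> in_xn p i"]) auto
    finally show ?thesis .
  qed
  also have "\<dots> = (\<Oplus>i\<in>{..N}. in_xn p i \<otimes> (\<sigma> ^^ i) (q (N - i)))"
  proof (intro finsum_cong')
    fix i
    show "q (N - i) \<otimes> in_xn p i = in_xn p i \<otimes> (\<sigma> ^^ i) (q (N - i))"
    proof (cases "n dvd i")
      case True
      then have "(\<sigma> ^^ i) (q (N - i)) = q (N - i)" using assms funpow_n_mult by auto
      then show ?thesis using assms PL by (simp add: m_comm)
    qed (use assms in \<open>simp add: in_xn_def\<close>)
  qed (use assms PL in auto)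
  finally show "(in_xn p \<otimes>\<^bsub>R\<^esub> q) N = (q \<otimes>\<^bsub>R\<^esub> in_xn p) N"
    using assms by (simp add: mult_apply in_xn_closed)
qed

text \<open>\<open>finsum\<close> depends on the carrier, and the product of \<open>Ky\<close> is
  defined by sums in the subring.\<close>

lemma K_finsum:
  assumes "finite A" "f \<in> A \<rightarrow> K" shows "finsum (subring_on L K) f A = finsum L f A"
proof -
  interpret LK: ring "subring_on L K" by (rule ring_LK)
  show ?thesis using assms
  proof (induct A)
    case empty
    show ?case using LK.finsum_empty by simp
  next
    case (insert x A)
    then show ?case using K_subset LK.finsum_insert[of A x f] by (subst finsum_insert) (auto simp: Pi_def)
  qed
qed

lemma Ky_mult_apply:
  "\<lbrakk>p \<in> carrier Ky; q \<in> carrier Ky\<rbrakk> \<Longrightarrow> (p \<otimes>\<^bsub>Ky\<^esub> q) m = (\<Oplus>i\<in>{..m}. p i \<otimes> q (m - i))"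
  using K_finsum[of "{..m}" "\<lambda>i. p i \<otimes> q (m - i)"] carrier_Ky by (auto simp: UP_def Pi_def)

lemma Ky_add_apply: "\<lbrakk>p \<in> carrier Ky; q \<in> carrier Ky\<rbrakk> \<Longrightarrow> (p \<oplus>\<^bsub>Ky\<^esub> q) m = p m \<oplus> q m"
  by (simp add: UP_def)

lemma Ky_one_apply: "\<one>\<^bsub>Ky\<^esub> = (\<lambda>i. if i = 0 then \<one> else \<zero>)" by (auto simp: UP_def)
lemma Ky_zero_apply: "\<zero>\<^bsub>Ky\<^esub> = (\<lambda>i. \<zero>)" by (simp add: UP_def)

lemma Ky_cring: "cring Ky"
proof -
  interpret LK: field "subring_on L K" by (rule field_LK)
  interpret U: UP_cring "subring_on L K" Ky by unfold_locales simp
  show ?thesis by (rule U.UP_cring)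
qed

lemma in_xn_add:
  assumes "p \<in> carrier Ky" "q \<in> carrier Ky"
  shows "in_xn (p \<oplus>\<^bsub>Ky\<^esub> q) = in_xn p \<oplus>\<^bsub>R\<^esub> in_xn q"
  using in_xn_closed[OF assms(1)] in_xn_closed[OF assms(2)] assms
  by (intro ext) (auto simp: in_xn_def Ky_add_apply)

lemma in_xn_one: "in_xn \<one>\<^bsub>Ky\<^esub> = \<one>\<^bsub>R\<^esub>"
  using n_pos by (auto simp: in_xn_def Ky_one_apply one_apply dvd_div_eq_0_iff)

text \<open>Only pairs of exponents that are both multiples of \<open>n\<close> contribute, and no
  twist occurs because the coefficients lie in \<open>K\<close>.\<close>

lemma in_xn_mult:
  assumes p: "p \<in> carrier Ky" and q: "q \<in> carrier Ky"
  shows "in_xn (p \<otimes>\<^bsub>Ky\<^esub> q) = in_xn p \<otimes>\<^bsub>R\<^esub> in_xn q"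
proof
  fix N
  have P: "in_xn p i \<in> K" "in_xn q i \<in> K" for i using in_xn_K p q carrier_Ky by blast+
  have PL: "in_xn p i \<in> carrier L" "in_xn q i \<in> carrier L" for i using P K_mem_L by blast+
  have pq: "p i \<in> carrier L" "q i \<in> carrier L" for i using p q K_mem_L carrier_Ky by blast+
  have 1: "(in_xn p \<otimes>\<^bsub>R\<^esub> in_xn q) N = (\<Oplus>i\<in>{..N}. in_xn p i \<otimes> in_xn q (N - i))"
    using p q P by (simp add: mult_apply in_xn_closed)
  show "in_xn (p \<otimes>\<^bsub>Ky\<^esub> q) N = (in_xn p \<otimes>\<^bsub>R\<^esub> in_xn q) N"
  proof (cases "n dvd N")
    case False
    have "(\<Oplus>i\<in>{..N}. in_xn p i \<otimes> in_xn q (N - i)) = (\<Oplus>i\<in>{..N}. \<zero>)"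
    proof (intro finsum_cong')
      fix i assume "i \<in> {..N}"
      then have "\<not> n dvd i \<or> \<not> n dvd (N - i)" using False dvd_add[of n i "N - i"] by auto
      then show "in_xn p i \<otimes> in_xn q (N - i) = \<zero>" using PL[of i] PL[of "N - i"] pq by (auto simp: in_xn_def)
    qed auto
    then show ?thesis using False 1 by (simp add: in_xn_def)
  next
    case True
    then obtain m where m: "N = n * m" by auto
    have "(\<Oplus>i\<in>{..N}. in_xn p i \<otimes> in_xn q (N - i)) = (\<Oplus>i\<in>(\<lambda>j. n * j) ` {..m}. in_xn p i \<otimes> in_xn q (N - i))"
    proof (rule add.finprod_mono_neutral_cong_right)
      show "in_xn p i \<otimes> in_xn q (N - i) = \<zero>" if "i \<in> {..N} - (\<lambda>j. n * j) ` {..m}" for i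
      proof -
        have "\<not> n dvd i"
        proof
          assume "n dvd i"
          then obtain j where "i = n * j" by auto
          then show False using that m n_pos by auto
        qed
        then show ?thesis using PL by (simp add: in_xn_def)
      qed
    qed (use PL m in auto)
    also have "\<dots> = (\<Oplus>j\<in>{..m}. in_xn p (n * j) \<otimes> in_xn q (N - n * j))"
      using PL n_pos by (intro add.finprod_reindex) (auto simp: inj_on_def)
    also have "\<dots> = (\<Oplus>j\<in>{..m}. p j \<otimes> q (m - j))"
      using pq by (intro finsum_cong') (auto simp: m in_xn_mult_n right_diff_distrib'[symmetric])
    also have "\<dots> = in_xn (p \<otimes>\<^bsub>Ky\<^esub> q) N"
      using p q by (simp add: m in_xn_mult_n Ky_mult_apply)
    finally show ?thesis using 1 by simp
  qed
qed

lemma eval_at_xn_eq: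
  assumes F: "F \<in> carrier Ky" shows "eval_at_xn L K R n F = in_xn F"
proof
  fix k
  interpret LK: ring "subring_on L K" by (rule ring_LK)
  interpret U: UP_ring "subring_on L K" Ky by unfold_locales simp
  have cf: "up_ring.coeff Ky F i = F i" for i using F unfolding UP_def by simp
  have FK: "F i \<in> carrier L" for i using F carrier_Ky K_mem_L by blast
  let ?d = "deg (subring_on L K) F"
  have above: "F i = \<zero>" if "?d < i" for i using U.deg_aboveD[OF that F] cf by simp
  have pow: "(mon \<one> 1 [^]\<^bsub>R\<^esub> n) [^]\<^bsub>R\<^esub> i = mon \<one> (n * i)" for i :: nat
    unfolding R.nat_pow_pow[OF R_monom_closed[OF one_closed]] by (rule monom_pow)
  have "eval_at_xn L K R n F = (\<Oplus>\<^bsub>R\<^esub>i\<in>{..?d}. mon (F i) 0 \<otimes>\<^bsub>R\<^esub> mon \<one> (n * i))"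
    unfolding eval_at_xn_def U.eval_on_carrier[OF F] pow cf ..
  also have "\<dots> = (\<Oplus>\<^bsub>R\<^esub>i\<in>{..?d}. mon (F i) (n * i))"
    using FK by (intro R.finsum_cong') (auto simp: monom_mult_monom)
  finally have "eval_at_xn L K R n F k = (\<Oplus>\<^bsub>R\<^esub>i\<in>{..?d}. mon (F i) (n * i)) k" by (rule fun_cong)
  also have "\<dots> = (\<Oplus>i\<in>{..?d}. mon (F i) (n * i) k)"
    using FK by (intro finsum_apply) auto
  also have "\<dots> = in_xn F k"
  proof (cases "n dvd k \<and> k div n \<le> ?d")
    case True
    then obtain j where j: "k = n * j" by blast
    have jd: "j \<le> ?d" using True n_pos unfolding j by simp
    have "(\<Oplus>i\<in>{..?d}. mon (F i) (n * i) k) = mon (F j) (n * j) k"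
    proof (rule finsum_only)
      show "mon (F i) (n * i) k = \<zero>" if "i \<noteq> j" for i
        using that n_pos FK unfolding j by (subst monom_apply) auto
    qed (use jd FK in auto)
    then show ?thesis unfolding j using FK by (simp add: monom_apply in_xn_mult_n)
  next
    case False
    have "mon (F i) (n * i) k = \<zero>" if i: "i \<in> {..?d}" for i
    proof -
      have "k \<noteq> n * i"
      proof
        assume "k = n * i"
        then show False using False i n_pos by simp
      qed
      then show ?thesis using FK by (simp add: monom_apply)
    qed
    then have "(\<Oplus>i\<in>{..?d}. mon (F i) (n * i) k) = \<zero>" by (simp cong: finsum_cong)
    moreover have "in_xn F k = \<zero>"
    proof (cases "n dvd k")
      case True
      then have "?d < k div n" using False by simp
      then have "F (k div n) = \<zero>" by (rule above)
      then show ?thesis by (simp only: in_xn_def if_True True)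
    qed (simp add: in_xn_def)
    ultimately show ?thesis by (rule trans[OF _ sym])
  qed
  finally show "eval_at_xn L K R n F k = in_xn F k" .
qed

end

text \<open>\<open>F_lead\<close> and \<open>F_above\<close> permit division by
  \<open>F(x^n)\<close>. \<open>F_const\<close> makes \<open>x\<close> invertible modulo it;
  \<open>irreducible_const_neq_zero\<close> derives it from irreducibility and
  \<open>F \<noteq> y\<close>. \<open>n_ge_2\<close> ensures that \<open>n\<close> does not divide
  \<open>s * n - 1\<close>.\<close>

locale skew_quotient = cyclic_galois L K \<sigma> n for L (structure) and K \<sigma> n +
  fixes F :: "nat \<Rightarrow> 'a" and s :: nat
  assumes F_K: "F i \<in> K" and F_lead: "F s = \<one>" and F_above: "s < i \<Longrightarrow> F i = \<zero>"
    and F_const: "F 0 \<noteq> \<zero>" and n_ge_2: "2 \<le> n"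
begin

section \<open>The ideal of F(x^n) and reduced representatives\<close>

abbreviation G where "G \<equiv> in_xn F"
abbreviation I where "I \<equiv> PIdl\<^bsub>R\<^esub> G"
abbreviation M where "M \<equiv> R Quot I"
abbreviation cl where "cl p \<equiv> I +>\<^bsub>R\<^esub> p"

lemma F_closed: "F \<in> carrier Ky" using F_K F_above carrier_Ky by blast
lemma F_L: "F i \<in> carrier L" using F_K K_mem_L by blast
lemma G_closed [simp]: "G \<in> carrier R" by (rule in_xn_closed[OF F_closed])
lemma G_K: "G i \<in> K" by (rule in_xn_K) (rule F_K)
lemma G_lead: "G (s * n) = \<one>" using in_xn_mult_n[of F s] F_lead by (simp add: mult.commute)
lemma G_above: "s * n < i \<Longrightarrow> G i = \<zero>"
proof (cases "n dvd i")
  case True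
  then obtain j where j: "i = n * j" by blast
  assume "s * n < i"
  then have "s < j" using n_pos unfolding j by (simp add: mult.commute)
  then show ?thesis unfolding j in_xn_mult_n by (rule F_above)
qed (simp add: in_xn_def)
lemma G_const: "G 0 = F 0" by (simp add: in_xn_def)

lemma G_central: "q \<in> carrier R \<Longrightarrow> G \<otimes>\<^bsub>R\<^esub> q = q \<otimes>\<^bsub>R\<^esub> G"
  by (rule in_xn_central[OF F_closed])

lemma I_iff: "p \<in> I \<longleftrightarrow> (\<exists>q\<in>carrier R. p = q \<otimes>\<^bsub>R\<^esub> G)"
  by (auto simp: cgenideal_def)

text \<open>By definition \<open>I\<close> consists of the left multiples of \<open>G\<close>; it
  absorbs factors on the right because \<open>G\<close> is central.\<close>

lemma I_ideal: "ideal I R"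
proof (rule idealI[OF R_ring])
  show "subgroup I (add_monoid R)"
  proof (rule R.add.subgroupI)
    show "I \<subseteq> carrier R" by (auto simp: I_iff)
    show "I \<noteq> {}" using R.one_closed by (auto simp: cgenideal_def)
    fix a assume a: "a \<in> I"
    then show "\<ominus>\<^bsub>R\<^esub> a \<in> I" by (auto simp: I_iff R.l_minus[symmetric] intro!: bexI)
    fix b assume b: "b \<in> I"
    from a b show "a \<oplus>\<^bsub>R\<^esub> b \<in> I" by (auto simp: I_iff R.l_distr[symmetric] intro!: bexI)
  qed
  fix a x assume a: "a \<in> I" and x: "x \<in> carrier R"
  then show "x \<otimes>\<^bsub>R\<^esub> a \<in> I" by (auto simp: I_iff R.m_assoc[symmetric] intro!: bexI)
  obtain q where q: "q \<in> carrier R" "a = q \<otimes>\<^bsub>R\<^esub> G" using a I_iff by blast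
  then have "a \<otimes>\<^bsub>R\<^esub> x = (q \<otimes>\<^bsub>R\<^esub> x) \<otimes>\<^bsub>R\<^esub> G" using x G_central[OF x] by (simp add: R.m_assoc)
  then show "a \<otimes>\<^bsub>R\<^esub> x \<in> I" using q x I_iff by blast
qed

sublocale I: ideal I R by (rule I_ideal)
sublocale M: ring M by (rule I.quotient_is_ring)

lemma cl_eq_iff: "\<lbrakk>p \<in> carrier R; q \<in> carrier R\<rbrakk> \<Longrightarrow> cl p = cl q \<longleftrightarrow> p \<ominus>\<^bsub>R\<^esub> q \<in> I"
  using R.quotient_eq_iff_same_a_r_cos[OF I_ideal] by simp

lemma cl_mult: "\<lbrakk>p \<in> carrier R; q \<in> carrier R\<rbrakk> \<Longrightarrow> cl p \<otimes>\<^bsub>M\<^esub> cl q = cl (p \<otimes>\<^bsub>R\<^esub> q)"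
  by (simp add: FactRing_def I.rcoset_mult_add)

lemma cl_add: "\<lbrakk>p \<in> carrier R; q \<in> carrier R\<rbrakk> \<Longrightarrow> cl p \<oplus>\<^bsub>M\<^esub> cl q = cl (p \<oplus>\<^bsub>R\<^esub> q)"
  by (simp add: FactRing_def I.a_rcos_sum)

lemma cl_one: "\<one>\<^bsub>M\<^esub> = cl \<one>\<^bsub>R\<^esub>" by (simp add: FactRing_def)

lemma M_carrier: "A \<in> carrier M \<longleftrightarrow> (\<exists>p\<in>carrier R. A = cl p)"
  by (auto simp: FactRing_def A_RCOSETS_def')

lemma cl_closed [simp]: "p \<in> carrier R \<Longrightarrow> cl p \<in> carrier M" using M_carrier by blast

text \<open>A nonzero multiple of the monic \<open>G\<close> has degree at least
  \<open>s * n\<close>: the top coefficient of the cofactor reappears \<open>s * n\<close> places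
  higher. This is the uniqueness of reduced representatives.\<close>

lemma I_bounded_zero:
  assumes p: "p \<in> I" and bd: "\<And>i. s * n \<le> i \<Longrightarrow> p i = \<zero>"
  shows "p = \<zero>\<^bsub>R\<^esub>"
proof -
  obtain q where q: "q \<in> carrier R" "p = q \<otimes>\<^bsub>R\<^esub> G" using p I_iff by blast
  have "q i = \<zero>" for i
  proof (rule ccontr)
    assume i: "q i \<noteq> \<zero>"
    obtain N where N: "\<And>i. N \<le> i \<Longrightarrow> q i = \<zero>" using R_bounded[OF q(1)] by blast
    have fin: "finite {i. q i \<noteq> \<zero>}"
    proof (rule finite_subset)
      show "{i. q i \<noteq> \<zero>} \<subseteq> {..N}" using N nat_le_linear by blast
    qed simp
    define e where "e = Max {i. q i \<noteq> \<zero>}"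
    have qe: "q e \<noteq> \<zero>" using Max_in[OF fin] i unfolding e_def by blast
    have above: "q j = \<zero>" if "e < j" for j
      using Max_ge[OF fin, of j] that unfolding e_def[symmetric] by auto
    have "p (e + s * n) = (\<Oplus>i\<in>{..e + s * n}. q i \<otimes> (\<sigma> ^^ i) (G (e + s * n - i)))"
      using q by (simp add: mult_apply)
    also have "\<dots> = q e \<otimes> (\<sigma> ^^ e) (G (e + s * n - e))"
    proof (rule finsum_only)
      fix i assume "i \<in> {..e + s * n}" "i \<noteq> e"
      then consider "e < i" | "s * n < e + s * n - i" by fastforce
      then show "q i \<otimes> (\<sigma> ^^ i) (G (e + s * n - i)) = \<zero>"
        using above G_above q by cases auto
    qed (use q in auto)
    also have "\<dots> = q e" using q G_lead by simp
    finally show False using bd[of "e + s * n"] qe by simp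
  qed
  then have "q = \<zero>\<^bsub>R\<^esub>" by auto
  then show ?thesis using q by simp
qed

lemma cl_eq_bounded:
  assumes "p \<in> carrier R" "q \<in> carrier R" "cl p = cl q"
    and "\<And>i. s * n \<le> i \<Longrightarrow> p i = \<zero>" "\<And>i. s * n \<le> i \<Longrightarrow> q i = \<zero>"
  shows "p = q"
proof -
  have "p \<ominus>\<^bsub>R\<^esub> q = \<zero>\<^bsub>R\<^esub>"
    using assms cl_eq_iff[OF assms(1,2)] by (intro I_bounded_zero) (auto simp: a_minus_def)
  then show ?thesis using assms by simp
qed

text \<open>Division by \<open>G\<close>: the coefficient \<open>c\<close> in degree
  \<open>s * n + N\<close> is cleared by \<open>c x^N G\<close>, whose top coefficient is
  \<open>c\<close> since the twist fixes the leading \<open>\<one>\<close> of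
  \<open>G\<close>.\<close>

lemma reduced_representative_aux:
  assumes "p \<in> carrier R" "\<And>i. s * n + N \<le> i \<Longrightarrow> p i = \<zero>"
  shows "\<exists>r\<in>carrier R. (\<forall>i\<ge>s * n. r i = \<zero>) \<and> p \<ominus>\<^bsub>R\<^esub> r \<in> I"
  using assms
proof (induct N arbitrary: p)
  case 0
  then have "p \<ominus>\<^bsub>R\<^esub> p \<in> I" by (simp add: a_minus_def R.r_neg I.zero_closed)
  moreover have "\<forall>i\<ge>s * n. p i = \<zero>" using 0(2) by simp
  ultimately show ?case using 0(1) by blast
next
  case (Suc N)
  define c where "c = p (s * n + N)"
  have c: "c \<in> carrier L" using Suc by (simp add: c_def)
  define m where "m = mon c N \<otimes>\<^bsub>R\<^esub> G"
  have m: "m \<in> carrier R" "m \<in> I" using c I_iff unfolding m_def by (auto simp: R.m_closed)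
  define q where "q = p \<ominus>\<^bsub>R\<^esub> m"
  have q: "q \<in> carrier R" using m Suc by (simp add: q_def)
  have "q i = \<zero>" if i: "s * n + N \<le> i" for i
  proof -
    have qi: "q i = p i \<ominus> c \<otimes> (\<sigma> ^^ N) (G (i - N))"
      using c Suc m i by (simp add: q_def m_def monom_mult_apply)
    show ?thesis
    proof (cases "i = s * n + N")
      case True then show ?thesis using qi G_lead c by (simp add: c_def[symmetric] a_minus_def r_neg)
    next
      case False then show ?thesis using qi i Suc(3)[of i] c G_above[of "i - N"] by (simp add: a_minus_def)
    qed
  qed
  then obtain r where r: "r \<in> carrier R" "\<forall>i\<ge>s * n. r i = \<zero>" "q \<ominus>\<^bsub>R\<^esub> r \<in> I"
    using Suc(1)[OF q] by blast
  have "p \<ominus>\<^bsub>R\<^esub> r = (q \<ominus>\<^bsub>R\<^esub> r) \<oplus>\<^bsub>R\<^esub> m"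
    unfolding q_def using Suc(2) m(1) r(1) by algebra
  then show ?case using r m(2) I.a_closed by auto
qed

lemma reduced_representative:
  assumes "A \<in> carrier M"
  obtains r where "r \<in> carrier R" "A = cl r" "\<And>i. s * n \<le> i \<Longrightarrow> r i = \<zero>"
proof -
  obtain p where p: "p \<in> carrier R" "A = cl p" using assms M_carrier by blast
  obtain N where N: "\<And>i. N \<le> i \<Longrightarrow> p i = \<zero>" using R_bounded[OF p(1)] by blast
  obtain r where "r \<in> carrier R" "\<forall>i\<ge>s * n. r i = \<zero>" "p \<ominus>\<^bsub>R\<^esub> r \<in> I"
    using reduced_representative_aux[OF p(1), of N] N by auto
  then show ?thesis using that p cl_eq_iff by auto
qed


section \<open>The centre of the quotient\<close>

lemma cl_eq_zero_iff: "p \<in> carrier R \<Longrightarrow> cl p = \<zero>\<^bsub>M\<^esub> \<longleftrightarrow> p \<in> I"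
  using cl_eq_iff[of p "\<zero>\<^bsub>R\<^esub>"] ring_hom_zero[OF I.rcos_ring_hom R_ring M.ring_axioms]
  by (simp add: a_minus_def)

lemma two_le_s_n: "s > 0 \<Longrightarrow> 2 \<le> s * n"
  using n_ge_2 mult_le_mono[of 1 s 2 n] by simp

lemma cl_in_xn_center:
  assumes "p \<in> carrier Ky" shows "cl (in_xn p) \<in> ring_center M"
  unfolding ring_center_def
proof (intro CollectI conjI ballI)
  show "cl (in_xn p) \<in> carrier M" using in_xn_closed[OF assms] by simp
  fix Y assume "Y \<in> carrier M"
  then obtain q where "q \<in> carrier R" "Y = cl q" using M_carrier by blast
  then show "cl (in_xn p) \<otimes>\<^bsub>M\<^esub> Y = Y \<otimes>\<^bsub>M\<^esub> cl (in_xn p)"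
    using in_xn_closed[OF assms] in_xn_central[OF assms] by (simp add: cl_mult)
qed

text \<open>Commuting with the constants confines a reduced representative to exponents divisible by
  \<open>n\<close>; commuting with \<open>x\<close> makes its coefficients fixed by
  \<open>\<sigma>\<close>.\<close>

lemma ring_center_eq:
  assumes s: "s > 0" shows "ring_center M = (\<lambda>p. cl (in_xn p)) ` carrier Ky"
proof
  show "(\<lambda>p. cl (in_xn p)) ` carrier Ky \<subseteq> ring_center M" using cl_in_xn_center by blast
  show "ring_center M \<subseteq> (\<lambda>p. cl (in_xn p)) ` carrier Ky"
  proof
    fix A assume A: "A \<in> ring_center M"
    then have AM: "A \<in> carrier M" and comm: "\<And>q. q \<in> carrier R \<Longrightarrow> A \<otimes>\<^bsub>M\<^esub> cl q = cl q \<otimes>\<^bsub>M\<^esub> A"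
      by (auto simp: ring_center_def)
    obtain r where r: "r \<in> carrier R" "A = cl r" and bd: "\<And>i. s * n \<le> i \<Longrightarrow> r i = \<zero>"
      using reduced_representative[OF AM] by blast
    have dvd: "n dvd i" if i: "r i \<noteq> \<zero>" for i
    proof (rule funpow_eq_id_imp_dvd)
      fix b assume b: "b \<in> carrier L"
      have "r \<otimes>\<^bsub>R\<^esub> mon b 0 = mon b 0 \<otimes>\<^bsub>R\<^esub> r"
      proof (rule cl_eq_bounded)
        show "cl (r \<otimes>\<^bsub>R\<^esub> mon b 0) = cl (mon b 0 \<otimes>\<^bsub>R\<^esub> r)"
          using comm[of "mon b 0"] r b by (simp add: cl_mult)
      qed (use r b bd in \<open>auto simp: mult_monom_apply monom_mult_apply\<close>)
      then have "(r \<otimes>\<^bsub>R\<^esub> mon b 0) i = (mon b 0 \<otimes>\<^bsub>R\<^esub> r) i" by (rule fun_cong)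
      then have "r i \<otimes> (\<sigma> ^^ i) b = b \<otimes> r i"
        using r b by (simp add: mult_monom_apply monom_mult_apply)
      then have "r i \<otimes> (\<sigma> ^^ i) b = r i \<otimes> b" using r b by (simp add: m_comm)
      then show "(\<sigma> ^^ i) b = b" using i r b m_lcancel by auto
    qed
    \<comment> \<open>Multiplication by \<open>x\<close> raises the degree, so the coefficient in
      degree \<open>s * n - 1\<close> must vanish before the products with \<open>x\<close> can be
      compared as reduced polynomials.\<close>
    have last: "r (s * n - 1) = \<zero>"
    proof (rule ccontr)
      assume "r (s * n - 1) \<noteq> \<zero>"
      then have "n dvd s * n - 1" by (rule dvd)
      then have "n dvd s * n - (s * n - 1)" by (rule dvd_diff_nat[OF dvd_triv_right])
      moreover have "s * n - (s * n - 1) = 1" using two_le_s_n[OF s] by simp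
      ultimately show False using n_ge_2 by simp
    qed
    have rK: "r i \<in> K" for i
    proof -
      have "r \<otimes>\<^bsub>R\<^esub> mon \<one> 1 = mon \<one> 1 \<otimes>\<^bsub>R\<^esub> r"
      proof (rule cl_eq_bounded)
        show "cl (r \<otimes>\<^bsub>R\<^esub> mon \<one> 1) = cl (mon \<one> 1 \<otimes>\<^bsub>R\<^esub> r)"
          using comm[of "mon \<one> 1"] r by (simp add: cl_mult)
        fix j assume j: "s * n \<le> j"
        have "r (j - 1) = \<zero>"
        proof (cases "j = s * n")
          case False
          then show ?thesis using bd[of "j - 1"] j by simp
        qed (use last in simp)
        then show "(r \<otimes>\<^bsub>R\<^esub> mon \<one> 1) j = \<zero>" "(mon \<one> 1 \<otimes>\<^bsub>R\<^esub> r) j = \<zero>"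
          using r by (auto simp: mult_monom_apply monom_mult_apply)
      qed (use r in auto)
      then have "(r \<otimes>\<^bsub>R\<^esub> mon \<one> 1) (Suc i) = (mon \<one> 1 \<otimes>\<^bsub>R\<^esub> r) (Suc i)" by (rule fun_cong)
      then have "\<sigma> (r i) = r i"
        using r funpow_closed[of "r i" 1] by (simp add: mult_monom_apply monom_mult_apply)
      then show "r i \<in> K" using r by (intro fixed_imp_K) auto
    qed
    define p where "p = (\<lambda>i. r (n * i))"
    have "p i = \<zero>" if "s \<le> i" for i
      unfolding p_def using that bd[of "n * i"] by (simp add: mult.commute)
    then have p: "p \<in> carrier Ky" using rK by (auto simp: carrier_Ky p_def intro!: exI[of _ s])
    have "r i = \<zero>" if "\<not> n dvd i" for i using dvd that by blast
    then have "in_xn p = r" by (auto simp: in_xn_def p_def fun_eq_iff)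
    then show "A \<in> (\<lambda>p. cl (in_xn p)) ` carrier Ky" using p r by (intro image_eqI[of _ _ p]) auto
  qed
qed

lemma Ky_division:
  assumes p: "p \<in> carrier Ky"
  shows "\<exists>q r. q \<in> carrier Ky \<and> r \<in> carrier Ky \<and> p = q \<otimes>\<^bsub>Ky\<^esub> F \<oplus>\<^bsub>Ky\<^esub> r \<and> (\<forall>i\<ge>s. r i = \<zero>)"
proof -
  interpret LK: field "subring_on L K" by (rule field_LK)
  interpret U: UP_domain "subring_on L K" Ky by unfold_locales simp
  have cf: "up_ring.coeff Ky q i = q i" if "q \<in> carrier Ky" for q i using that unfolding UP_def by simp
  have d: "deg (subring_on L K) F = s"
  proof (rule antisym)
    show "deg (subring_on L K) F \<le> s"
      using F_above F_closed cf by (intro U.deg_aboveI) auto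
    show "s \<le> deg (subring_on L K) F"
      using F_lead F_closed cf by (intro U.deg_belowI) auto
  qed
  have F0: "F \<noteq> \<zero>\<^bsub>Ky\<^esub>" using F_const by (auto simp: Ky_zero_apply)
  obtain q r and k :: nat where q: "q \<in> carrier Ky" and r: "r \<in> carrier Ky"
    and e: "(up_ring.coeff Ky F (deg (subring_on L K) F)) [^]\<^bsub>subring_on L K\<^esub> k \<odot>\<^bsub>Ky\<^esub> p = F \<otimes>\<^bsub>Ky\<^esub> q \<oplus>\<^bsub>Ky\<^esub> r"
    and dr: "r = \<zero>\<^bsub>Ky\<^esub> \<or> deg (subring_on L K) r < deg (subring_on L K) F"
    using U.long_div_theorem[OF F_closed p F0] by blast
  \<comment> \<open>\<open>long_div_theorem\<close> divides a multiple of \<open>p\<close> by a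
    power of the leading coefficient of \<open>F\<close>; that power is \<open>\<one>\<close>
    here.\<close>
  have lead: "up_ring.coeff Ky F (deg (subring_on L K) F) = \<one>\<^bsub>subring_on L K\<^esub>"
    using cf[OF F_closed] F_lead d by simp
  have "p = F \<otimes>\<^bsub>Ky\<^esub> q \<oplus>\<^bsub>Ky\<^esub> r" using e unfolding lead LK.nat_pow_one U.UP_smult_one[OF p] .
  then have "p = q \<otimes>\<^bsub>Ky\<^esub> F \<oplus>\<^bsub>Ky\<^esub> r" unfolding U.UP_m_comm[OF F_closed q] .
  moreover have "r i = \<zero>" if "s \<le> i" for i
    using dr
  proof
    assume "r = \<zero>\<^bsub>Ky\<^esub>" then show ?thesis by (simp add: Ky_zero_apply)
  next
    assume "deg (subring_on L K) r < deg (subring_on L K) F"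
    then have "deg (subring_on L K) r < i" using d that by simp
    from U.deg_aboveD[OF this r] show ?thesis using cf[OF r] by simp
  qed
  ultimately show ?thesis using q r by blast
qed

text \<open>The remainder of \<open>p\<close> modulo \<open>F\<close> becomes, after substitution,
  an element of \<open>I\<close> of degree below \<open>s * n\<close>, hence zero.\<close>

lemma in_xn_mem_I_iff:
  assumes p: "p \<in> carrier Ky"
  shows "in_xn p \<in> I \<longleftrightarrow> p \<in> PIdl\<^bsub>Ky\<^esub> F"
proof
  interpret Ky: cring Ky by (rule Ky_cring)
  assume "p \<in> PIdl\<^bsub>Ky\<^esub> F"
  then obtain q where q: "q \<in> carrier Ky" "p = q \<otimes>\<^bsub>Ky\<^esub> F" by (auto simp: cgenideal_def)
  then show "in_xn p \<in> I" using I_iff in_xn_mult[OF q(1) F_closed] in_xn_closed by blast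
next
  interpret Ky: cring Ky by (rule Ky_cring)
  assume pI: "in_xn p \<in> I"
  obtain q r where q: "q \<in> carrier Ky" and r: "r \<in> carrier Ky"
    and e: "p = q \<otimes>\<^bsub>Ky\<^esub> F \<oplus>\<^bsub>Ky\<^esub> r" and bd: "\<forall>i\<ge>s. r i = \<zero>"
    using Ky_division[OF p] by blast
  have rR: "in_xn r \<in> carrier R" by (rule in_xn_closed[OF r])
  have qG: "in_xn q \<otimes>\<^bsub>R\<^esub> G \<in> I" using I_iff in_xn_closed[OF q] by blast
  have "in_xn p = in_xn q \<otimes>\<^bsub>R\<^esub> G \<oplus>\<^bsub>R\<^esub> in_xn r"
    unfolding e using in_xn_add in_xn_mult q r F_closed by simp
  then have "in_xn r = in_xn p \<ominus>\<^bsub>R\<^esub> in_xn q \<otimes>\<^bsub>R\<^esub> G"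
    using rR in_xn_closed[OF q] in_xn_closed[OF p] G_closed by algebra
  then have "in_xn r \<in> I"
    using pI qG I.a_closed I.a_inv_closed by (simp add: a_minus_def)
  then have z: "in_xn r = \<zero>\<^bsub>R\<^esub>"
  proof (rule I_bounded_zero)
    fix i assume i: "s * n \<le> i"
    then have "s \<le> i div n" using n_pos by (simp add: less_eq_div_iff_mult_less_eq)
    then show "in_xn r i = \<zero>" using bd by (simp add: in_xn_def)
  qed
  have "r i = \<zero>" for i using in_xn_mult_n[of r i] z by simp
  then have "r = \<zero>\<^bsub>Ky\<^esub>" by (auto simp: Ky_zero_apply)
  then show "p \<in> PIdl\<^bsub>Ky\<^esub> F" using e q F_closed by (auto simp: cgenideal_def)
qed

lemma ring_center_iso:
  assumes s: "s > 0"
  shows "subring_on M (ring_center M) \<simeq> Ky Quot (PIdl\<^bsub>Ky\<^esub> F)"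
proof -
  interpret Ky: cring Ky by (rule Ky_cring)
  let ?h = "\<lambda>p. cl (in_xn p)"
  have "?h \<in> ring_hom Ky M"
    by (rule ring_hom_memI) (auto simp: in_xn_closed cl_mult cl_add cl_one in_xn_mult in_xn_add in_xn_one)
  then interpret h: ring_hom_ring Ky M ?h
    by (rule ring_hom_ringI2[OF Ky.ring_axioms M.ring_axioms])
  have ker: "a_kernel Ky M ?h = PIdl\<^bsub>Ky\<^esub> F"
  proof -
    have "cl (in_xn p) = \<zero>\<^bsub>M\<^esub> \<longleftrightarrow> p \<in> PIdl\<^bsub>Ky\<^esub> F" if "p \<in> carrier Ky" for p
      using cl_eq_zero_iff[OF in_xn_closed[OF that]] in_xn_mem_I_iff[OF that] by blast
    moreover have "PIdl\<^bsub>Ky\<^esub> F \<subseteq> carrier Ky"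
      using F_closed unfolding cgenideal_def by blast
    ultimately show ?thesis unfolding a_kernel_def' by blast
  qed
  have "Ky Quot (PIdl\<^bsub>Ky\<^esub> F) \<simeq> subring_on M (ring_center M)"
    using h.FactRing_iso_set_aux unfolding ker ring_center_eq[OF s] is_ring_iso_def by blast
  moreover have "ring (Ky Quot (PIdl\<^bsub>Ky\<^esub> F))"
    using ideal.quotient_is_ring[OF Ky.cgenideal_ideal[OF F_closed]] .
  ultimately show ?thesis by (rule ring_iso_sym[rotated])
qed

section \<open>Constants and the class of x in the quotient\<close>

text \<open>Distinct constants are distinct reduced polynomials, so they have distinct classes. It
  is applied both to \<open>L'\<close> and to \<open>K\<close>.\<close>

lemma constants_iso:
  assumes A: "subring A L" and sn: "0 < s * n"
  shows "subring_on M ((\<lambda>a. cl (mon a 0)) ` A) \<simeq> subring_on L A"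
proof -
  have AL: "A \<subseteq> carrier L" by (rule subringE(1)[OF A])
  let ?h = "\<lambda>a. cl (mon a 0)"
  have "?h \<in> ring_iso (subring_on L A) (subring_on M (?h ` A))"
  proof (rule ring_iso_memI)
    fix a b assume "a \<in> carrier (subring_on L A)" "b \<in> carrier (subring_on L A)"
    then have ab: "a \<in> carrier L" "b \<in> carrier L" using AL by auto
    have m: "mon (a \<otimes> b) 0 = mon a 0 \<otimes>\<^bsub>R\<^esub> mon b 0" using ab by (simp add: monom_mult_monom)
    have p: "mon (a \<oplus> b) 0 = mon a 0 \<oplus>\<^bsub>R\<^esub> mon b 0" using ab by (auto simp: fun_eq_iff monom_apply)
    show "?h (a \<otimes>\<^bsub>subring_on L A\<^esub> b) = ?h a \<otimes>\<^bsub>subring_on M (?h ` A)\<^esub> ?h b"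
      using ab by (simp add: m cl_mult)
    show "?h (a \<oplus>\<^bsub>subring_on L A\<^esub> b) = ?h a \<oplus>\<^bsub>subring_on M (?h ` A)\<^esub> ?h b"
      using ab by (simp add: p cl_add)
  next
    show "?h \<one>\<^bsub>subring_on L A\<^esub> = \<one>\<^bsub>subring_on M (?h ` A)\<^esub>" by (simp add: cl_one one_eq_monom)
    have "inj_on ?h A"
    proof (rule inj_onI)
      fix a b assume a: "a \<in> A" and b: "b \<in> A" and e: "?h a = ?h b"
      then have ab: "a \<in> carrier L" "b \<in> carrier L" using AL by auto
      have "mon a 0 = mon b 0"
        using ab e sn by (intro cl_eq_bounded) (auto simp: monom_apply)
      then have "mon a 0 0 = mon b 0 0" by simp
      then show "a = b" using ab by (simp add: monom_apply)
    qed
    then show "bij_betw ?h (carrier (subring_on L A)) (carrier (subring_on M (?h ` A)))"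
      by (simp add: bij_betw_def)
  qed auto
  then have "subring_on L A \<simeq> subring_on M (?h ` A)" by (auto simp: is_ring_iso_def)
  then show ?thesis by (rule ring_iso_sym[OF subring_is_ring[OF A]])
qed

text \<open>The constants and the class of \<open>x\<close> generate \<open>M\<close> as a
  ring.\<close>

lemma cl_commutes_all:
  assumes A: "A \<in> carrier M"
    and const: "\<And>b. b \<in> carrier L \<Longrightarrow> A \<otimes>\<^bsub>M\<^esub> cl (mon b 0) = cl (mon b 0) \<otimes>\<^bsub>M\<^esub> A"
    and x: "A \<otimes>\<^bsub>M\<^esub> cl (mon \<one> 1) = cl (mon \<one> 1) \<otimes>\<^bsub>M\<^esub> A"
  shows "A \<in> ring_center M"
proof -
  have mon: "A \<otimes>\<^bsub>M\<^esub> cl (mon b i) = cl (mon b i) \<otimes>\<^bsub>M\<^esub> A" if b: "b \<in> carrier L" for b i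
  proof (induct i)
    case (Suc i)
    have e: "cl (mon b (Suc i)) = cl (mon b i) \<otimes>\<^bsub>M\<^esub> cl (mon \<one> 1)"
      using b by (simp add: cl_mult monom_mult_monom)
    have c: "cl (mon b i) \<in> carrier M" "cl (mon \<one> 1) \<in> carrier M" using b by auto
    show ?case unfolding e using c A x Suc
      by (metis M.m_assoc)
  qed (rule const[OF b])
  have all: "A \<otimes>\<^bsub>M\<^esub> cl q = cl q \<otimes>\<^bsub>M\<^esub> A"
    if "q \<in> carrier R" "\<And>i. N \<le> i \<Longrightarrow> q i = \<zero>" for N q
    using that
  proof (induct N arbitrary: q)
    case 0
    then have "q = \<zero>\<^bsub>R\<^esub>" by (auto simp: fun_eq_iff)
    then have "cl q = \<zero>\<^bsub>M\<^esub>" using cl_eq_zero_iff[of q] I.zero_closed by simp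
    then show ?case using A by simp
  next
    case (Suc N)
    define m where "m = mon (q N) N"
    have m: "m \<in> carrier R" using Suc by (simp add: m_def)
    define q' where "q' = q \<ominus>\<^bsub>R\<^esub> m"
    have q': "q' \<in> carrier R" using m Suc by (simp add: q'_def)
    have "q' i = \<zero>" if "N \<le> i" for i
      using that Suc m by (cases "i = N") (auto simp: q'_def m_def monom_apply a_minus_def r_neg)
    then have IH: "A \<otimes>\<^bsub>M\<^esub> cl q' = cl q' \<otimes>\<^bsub>M\<^esub> A" using Suc(1) q' by blast
    have "q = q' \<oplus>\<^bsub>R\<^esub> m" unfolding q'_def using m Suc(2) by algebra
    then have "cl q = cl q' \<oplus>\<^bsub>M\<^esub> cl m" using q' m by (simp add: cl_add)
    moreover have "A \<otimes>\<^bsub>M\<^esub> cl m = cl m \<otimes>\<^bsub>M\<^esub> A" unfolding m_def using mon Suc(2) by simp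
    ultimately show ?case using IH A q' m by (simp add: M.l_distr M.r_distr)
  qed
  have "A \<otimes>\<^bsub>M\<^esub> Y = Y \<otimes>\<^bsub>M\<^esub> A" if "Y \<in> carrier M" for Y
  proof -
    obtain q where q: "q \<in> carrier R" "Y = cl q" using \<open>Y \<in> carrier M\<close> M_carrier by blast
    obtain N where "\<And>i. N \<le> i \<Longrightarrow> q i = \<zero>" using R_bounded[OF q(1)] by blast
    then show ?thesis using all q by blast
  qed
  then show ?thesis using A by (simp add: ring_center_def)
qed

text \<open>Write \<open>F(x^n) = F 0 + x g\<close>; the coefficients of \<open>g\<close> lie in
  \<open>K\<close>, so pulling \<open>x\<close> out on the left causes no twist. Modulo
  \<open>I\<close> this makes \<open>- g / F 0\<close> a right inverse of \<open>x\<close>, which is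
  what cancelling \<open>x\<close> on the right requires.\<close>

lemma x_right_invertible: "\<exists>Y\<in>carrier M. cl (mon \<one> 1) \<otimes>\<^bsub>M\<^esub> Y = \<one>\<^bsub>M\<^esub>"
proof -
  define u where "u = inv (F 0)"
  have "F 0 \<in> Units L" using F_const F_L field_Units by simp
  then have u: "u \<in> carrier L" "u \<otimes> F 0 = \<one>" by (auto simp: u_def)
  have uK: "u \<in> K"
  proof (rule fixed_imp_K)
    have "\<sigma> u \<otimes> F 0 = \<sigma> (u \<otimes> F 0)"
      using ring_hom_mult[OF sigma_hom u(1) F_L[of 0]] sigma_fixes_K[OF F_K[of 0]] by simp
    then have "\<sigma> u \<otimes> F 0 = u \<otimes> F 0" using u ring_hom_one[OF sigma_hom] by simp
    then show "\<sigma> u = u"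
      using m_rcancel[OF F_const F_L ring_hom_closed[OF sigma_hom u(1)] u(1)] by simp
  qed (rule u(1))
  define h where "h = (\<lambda>i. \<ominus> (u \<otimes> G (Suc i)))"
  have hK: "h i \<in> K" for i using uK G_K by (simp add: h_def)
  have h: "h \<in> carrier R"
    by (rule R_memI[of _ "s * n"]) (use hK K_mem_L G_above u in \<open>auto simp: h_def\<close>)
  have "mon \<one> 1 \<otimes>\<^bsub>R\<^esub> h \<ominus>\<^bsub>R\<^esub> \<one>\<^bsub>R\<^esub> = mon (\<ominus> u) 0 \<otimes>\<^bsub>R\<^esub> G"
  proof
    fix k
    show "(mon \<one> 1 \<otimes>\<^bsub>R\<^esub> h \<ominus>\<^bsub>R\<^esub> \<one>\<^bsub>R\<^esub>) k = (mon (\<ominus> u) 0 \<otimes>\<^bsub>R\<^esub> G) k"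
    proof (cases k)
      case 0
      then show ?thesis using h u F_L
        by (simp add: monom_mult_apply one_apply G_const l_minus a_minus_def)
    next
      case (Suc j)
      have "\<sigma> (h j) = h j" using hK sigma_fixes_K by blast
      then show ?thesis using Suc h u K_mem_L[OF hK] K_mem_L[OF G_K]
        by (simp add: monom_mult_apply one_apply l_minus a_minus_def) (simp add: h_def)
    qed
  qed
  then have "mon \<one> 1 \<otimes>\<^bsub>R\<^esub> h \<ominus>\<^bsub>R\<^esub> \<one>\<^bsub>R\<^esub> \<in> I" using u I_iff by auto
  then have "cl (mon \<one> 1) \<otimes>\<^bsub>M\<^esub> cl h = \<one>\<^bsub>M\<^esub>"
    using h cl_eq_iff[of "mon \<one> 1 \<otimes>\<^bsub>R\<^esub> h" "\<one>\<^bsub>R\<^esub>"] by (simp add: cl_mult cl_one)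
  then show ?thesis using h by (intro bexI[of _ "cl h"]) auto
qed

end

section \<open>The codes\<close>

locale skew_code = skew_quotient L K \<sigma> n F s for L (structure) and K \<sigma> n F s +
  fixes E :: "'a set" and \<gamma> :: 'a and d :: nat
  assumes subfield_E: "subfield E L" and K_E: "K \<subseteq> E" and dim_E: "dimension 2 E (carrier L)"
    and gamma: "\<gamma> \<in> carrier L" "\<gamma> \<noteq> \<zero>" and d_ge_2: "2 \<le> d" and d_le: "2 * d \<le> s * n"
begin

text \<open>The reduced representatives of the codewords, described coefficientwise; as
  \<open>d < s * n\<close>, membership in the code can be tested on them.\<close>

definition D where
  "D = {c \<in> carrier R. c 0 \<in> E \<and> (\<exists>a\<in>E. c d = \<gamma> \<otimes> a) \<and> (\<forall>i>d. c i = \<zero>)}"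

abbreviation \<C> where "\<C> \<equiv> D_code L E R I d \<gamma>"
abbreviation E_consts where "E_consts \<equiv> (\<lambda>a. cl (mon a 0)) ` E"

lemma s_pos: "0 < s" using d_ge_2 d_le by (cases s) auto
lemma d_less: "d < s * n" using d_ge_2 d_le by simp

lemma E_props [simp]:
  shows E_closed: "a \<in> E \<Longrightarrow> a \<in> carrier L" and "\<zero> \<in> E" and "\<one> \<in> E"
    and "a \<in> E \<Longrightarrow> b \<in> E \<Longrightarrow> a \<otimes> b \<in> E"
  using subringE[OF subfieldE(1)[OF subfield_E]] by auto

lemma funpow_E: "a \<in> E \<Longrightarrow> (\<sigma> ^^ i) a \<in> E"
  by (rule intermediate_field_invariant[OF subfield_E K_E dim_E])

lemma D_carrier: "c \<in> D \<Longrightarrow> c \<in> carrier R" by (simp add: D_def)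
lemma D_bounded: "\<lbrakk>c \<in> D; s * n \<le> i\<rbrakk> \<Longrightarrow> c i = \<zero>" using d_less by (simp add: D_def)

lemma code_eq: "\<C> = cl ` D"
proof
  let ?p = "\<lambda>a0 a a1. mon a0 0 \<oplus>\<^bsub>R\<^esub> (\<Oplus>\<^bsub>R\<^esub>i\<in>{1..d - 1}. mon (a i) i) \<oplus>\<^bsub>R\<^esub> mon (\<gamma> \<otimes> a1) d"
  have coeff: "?p a0 a a1 \<in> carrier R \<and> (\<forall>k. ?p a0 a a1 k =
      (if k = 0 then a0 else if k = d then \<gamma> \<otimes> a1 else if k < d then a k else \<zero>))"
    if a: "a0 \<in> E" "a1 \<in> E" "\<forall>i\<in>{1..d - 1}. a i \<in> carrier L" for a0 a a1
  proof -
    have m: "(\<lambda>i. mon (a i) i) \<in> {1..d - 1} \<rightarrow> carrier R" using a by auto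
    have c: "(\<Oplus>\<^bsub>R\<^esub>i\<in>{1..d - 1}. mon (a i) i) \<in> carrier R" using m by (rule R.finsum_closed)
    have sum: "(\<Oplus>\<^bsub>R\<^esub>i\<in>{1..d - 1}. mon (a i) i) k = (if 1 \<le> k \<and> k < d then a k else \<zero>)" for k
    proof -
      have "(\<Oplus>\<^bsub>R\<^esub>i\<in>{1..d - 1}. mon (a i) i) k = (\<Oplus>i\<in>{1..d - 1}. mon (a i) i k)"
        using m by (intro finsum_apply) auto
      also have "\<dots> = (if 1 \<le> k \<and> k < d then a k else \<zero>)"
      proof (cases "k \<in> {1..d - 1}")
        case True
        have "(\<Oplus>i\<in>{1..d - 1}. mon (a i) i k) = mon (a k) k k"
          using True a by (intro finsum_only) (auto simp: monom_apply)
        then show ?thesis using True a d_ge_2 by (auto simp: monom_apply)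
      next
        case False
        have "(\<Oplus>i\<in>{1..d - 1}. mon (a i) i k) = (\<Oplus>i\<in>{1..d - 1}. \<zero>)"
          using False a by (intro finsum_cong') (auto simp: monom_apply)
        then show ?thesis using False by auto
      qed
      finally show ?thesis .
    qed
    show ?thesis
    proof (intro conjI allI)
      show "?p a0 a a1 \<in> carrier R" using a c gamma by simp
      fix k
      have "?p a0 a a1 k = mon a0 0 k \<oplus> (if 1 \<le> k \<and> k < d then a k else \<zero>) \<oplus> mon (\<gamma> \<otimes> a1) d k"
        using a c gamma sum by simp
      then show "?p a0 a a1 k =
          (if k = 0 then a0 else if k = d then \<gamma> \<otimes> a1 else if k < d then a k else \<zero>)"
        using a gamma d_ge_2 by (auto simp: monom_apply)
    qed
  qed
  show "\<C> \<subseteq> cl ` D"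
  proof
    fix U assume "U \<in> \<C>"
    then obtain a0 a a1 where a: "a0 \<in> E" "a1 \<in> E" "\<forall>i\<in>{1..d - 1}. a i \<in> carrier L"
      and U: "U = cl (?p a0 a a1)" unfolding D_code_def by blast
    have "?p a0 a a1 \<in> D"
      using coeff[OF a] a d_ge_2 unfolding D_def by auto
    then show "U \<in> cl ` D" using U by blast
  qed
  show "cl ` D \<subseteq> \<C>"
  proof
    fix U assume "U \<in> cl ` D"
    then obtain c where c: "c \<in> D" "U = cl c" by blast
    then obtain a1 where a1: "a1 \<in> E" "c d = \<gamma> \<otimes> a1" unfolding D_def by blast
    have a: "c 0 \<in> E" "\<forall>i\<in>{1..d - 1}. c i \<in> carrier L" using c by (auto simp: D_def)
    have eq: "c = ?p (c 0) c a1"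
    proof
      fix k
      show "c k = ?p (c 0) c a1 k"
        using coeff[OF a(1) a1(1) a(2)] c(1) a1(2) unfolding D_def by (cases k d rule: linorder_cases) auto
    qed
    have "U = cl (?p (c 0) c a1)" unfolding c(2) by (rule arg_cong[OF eq])
    then show "U \<in> \<C>" using a a1 unfolding D_code_def
      by (intro CollectI exI[of _ "c 0"] exI[of _ c] exI[of _ a1]) simp
  qed
qed

lemma cl_mem_code_iff:
  assumes "p \<in> carrier R" "\<And>i. s * n \<le> i \<Longrightarrow> p i = \<zero>"
  shows "cl p \<in> \<C> \<longleftrightarrow> p \<in> D"
  unfolding code_eq using assms cl_eq_bounded D_carrier D_bounded by blast

lemma monom_in_D: "\<lbrakk>b \<in> carrier L; 0 < i; i < d\<rbrakk> \<Longrightarrow> mon b i \<in> D"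
  unfolding D_def using gamma(1) by (auto simp: monom_apply intro!: bexI[of _ \<zero>])

lemma const_in_D: "b \<in> E \<Longrightarrow> mon b 0 \<in> D"
  unfolding D_def using d_ge_2 gamma(1) by (auto simp: monom_apply intro!: bexI[of _ \<zero>])

text \<open>The products \<open>c \<otimes> b\<close> exhaust \<open>L\<close>, while
  \<open>\<gamma> E\<close> is a proper subset because \<open>E \<noteq> L\<close>. The witness
  solves \<open>c \<otimes> b = \<gamma> \<otimes> x\<close> for some \<open>x\<close> outside
  \<open>E\<close>.\<close>

lemma not_all_gamma_multiples:
  assumes c: "c \<in> carrier L" "c \<noteq> \<zero>"
  shows "\<exists>b\<in>carrier L. c \<otimes> b \<notin> (\<lambda>a. \<gamma> \<otimes> a) ` E"
proof -
  obtain x where x: "x \<in> carrier L" "x \<notin> E"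
    using intermediate_field_proper[OF subfield_E dim_E] by blast
  have "c \<in> Units L" using c field_Units by simp
  then have ic: "inv c \<in> carrier L" "c \<otimes> inv c = \<one>" by auto
  have "c \<otimes> (inv c \<otimes> (\<gamma> \<otimes> x)) = \<gamma> \<otimes> x"
    using c ic gamma x by (simp add: m_assoc[symmetric])
  moreover have "\<gamma> \<otimes> x \<noteq> \<gamma> \<otimes> a" if "a \<in> E" for a
    using that x gamma m_lcancel[OF gamma(2,1) x(1) E_closed[OF that]] by auto
  ultimately show ?thesis using ic x gamma by (intro bexI[of _ "inv c \<otimes> (\<gamma> \<otimes> x)"]) auto
qed

lemma eq_monom_0:
  assumes "c \<in> carrier R" "\<And>i. 0 < i \<Longrightarrow> c i = \<zero>"
  shows "c = mon (c 0) 0"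
  using assms by (auto simp: fun_eq_iff monom_apply)

lemma one_in_code: "\<one>\<^bsub>M\<^esub> \<in> \<C>"
  unfolding cl_one one_eq_monom code_eq using const_in_D[of \<one>] by auto

lemma sigma_surj: "b \<in> carrier L \<Longrightarrow> \<exists>a\<in>carrier L. \<sigma> a = b"
  using sigma_Bij unfolding Bij_def bij_betw_def by (auto simp: image_iff dest: sym)

text \<open>Since \<open>1\<close> lies in the code, so do the idealizers. Multiplying an element \<open>c\<close> of them by
  \<open>b x\<^sup>d\<^sup>-\<^sup>1\<close> causes no reduction modulo \<open>F(x\<^sup>n)\<close>, as \<open>2d - 1 < sn\<close>; the coefficients in degrees
  above \<open>d\<close> kill \<open>c\<^sub>i\<close> for \<open>i \<ge> 2\<close>, and the one in degree \<open>d\<close> kills \<open>c\<^sub>1\<close>, because \<open>b\<close> is arbitrary.\<close>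

lemma left_idealizer_code: "left_idealizer M \<C> = E_consts"
proof
  show "left_idealizer M \<C> \<subseteq> E_consts"
  proof
    fix A assume A: "A \<in> left_idealizer M \<C>"
    then have AM: "A \<in> carrier M" and idl: "\<And>Y. Y \<in> \<C> \<Longrightarrow> A \<otimes>\<^bsub>M\<^esub> Y \<in> \<C>"
      by (auto simp: left_idealizer_def)
    have "A \<in> \<C>" using idl[OF one_in_code] AM by simp
    then obtain c where c: "c \<in> D" "A = cl c" unfolding code_eq by blast
    have cR: "c \<in> carrier R" using c D_carrier by blast
    have prod: "c \<otimes>\<^bsub>R\<^esub> mon b (d - 1) \<in> D" if b: "b \<in> carrier L" for b
    proof -
      have m: "mon b (d - 1) \<in> D" using monom_in_D[OF b] d_ge_2 by simp
      then have "cl (mon b (d - 1)) \<in> \<C>" unfolding code_eq by blast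
      then have "A \<otimes>\<^bsub>M\<^esub> cl (mon b (d - 1)) \<in> \<C>" by (rule idl)
      then have "cl (c \<otimes>\<^bsub>R\<^esub> mon b (d - 1)) \<in> \<C>" unfolding c(2) cl_mult[OF cR R_monom_closed[OF b]] .
      moreover have "(c \<otimes>\<^bsub>R\<^esub> mon b (d - 1)) i = \<zero>" if "s * n \<le> i" for i
      proof -
        have "d < i - (d - 1)" using that d_ge_2 d_le by simp
        then have "c (i - (d - 1)) = \<zero>" using c(1) by (simp add: D_def)
        then show ?thesis using cR b by (simp add: mult_monom_apply)
      qed
      ultimately show ?thesis using cl_mem_code_iff cR b by simp
    qed
    have coeff: "(c \<otimes>\<^bsub>R\<^esub> mon b (d - 1)) (i + (d - 1)) = c i \<otimes> (\<sigma> ^^ i) b" if "b \<in> carrier L" for b i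
      using cR that by (simp add: mult_monom_apply)
    have "c i = \<zero>" if i: "0 < i" for i
    proof (cases "i = 1")
      case True
      have "c 1 \<otimes> b \<in> (\<lambda>a. \<gamma> \<otimes> a) ` E" if b: "b \<in> carrier L" for b
      proof -
        \<comment> \<open>The coefficient in degree \<open>d\<close> is
          \<open>c 1 \<otimes> \<sigma> b'\<close>; passing to a preimage under
          \<open>\<sigma>\<close> lets the second factor be any \<open>b\<close>.\<close>
        obtain b' where b': "b' \<in> carrier L" "\<sigma> b' = b" using sigma_surj[OF b] by blast
        have "(c \<otimes>\<^bsub>R\<^esub> mon b' (d - 1)) d = c 1 \<otimes> b"
          using coeff[OF b'(1), of 1] d_ge_2 b'(2) by simp
        then show ?thesis using prod[OF b'(1)] unfolding D_def by auto
      qed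
      then show ?thesis using not_all_gamma_multiples[of "c 1"] cR True by auto
    next
      case False
      then have "(c \<otimes>\<^bsub>R\<^esub> mon \<one> (d - 1)) (i + (d - 1)) = \<zero>"
        using prod[of \<one>] i d_ge_2 unfolding D_def by simp
      then show ?thesis using coeff[of \<one> i] cR by simp
    qed
    then have "c = mon (c 0) 0" by (rule eq_monom_0[OF cR])
    then have "A = cl (mon (c 0) 0)" unfolding c(2) by (rule arg_cong)
    moreover have "c 0 \<in> E" using c by (simp add: D_def)
    ultimately show "A \<in> E_consts" by (rule image_eqI)
  qed
  show "E_consts \<subseteq> left_idealizer M \<C>"
  proof
    fix A assume "A \<in> E_consts"
    then obtain e where e: "e \<in> E" "A = cl (mon e 0)" by blast
    have "A \<otimes>\<^bsub>M\<^esub> Y \<in> \<C>" if Y: "Y \<in> \<C>" for Y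
    proof -
      obtain c where c: "c \<in> D" "Y = cl c" using Y unfolding code_eq by blast
      have cR: "c \<in> carrier R" using c D_carrier by blast
      obtain a where a: "a \<in> E" "c d = \<gamma> \<otimes> a" using c unfolding D_def by blast
      have "e \<otimes> (\<gamma> \<otimes> a) = \<gamma> \<otimes> (e \<otimes> a)" using e a gamma by (simp add: m_lcomm)
      then have "mon e 0 \<otimes>\<^bsub>R\<^esub> c \<in> D"
        using c(1) e a cR gamma unfolding D_def
        by (auto simp: monom_mult_apply intro!: bexI[of _ "e \<otimes> a"])
      then show ?thesis using e c cR unfolding code_eq by (simp add: cl_mult)
    qed
    then show "A \<in> left_idealizer M \<C>" using e by (simp add: left_idealizer_def)
  qed
qed

text \<open>The mirror image of \<open>left_idealizer_code\<close>, with the twists elsewhere: they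
  now hit the coefficients of \<open>c\<close>, so injectivity of \<open>\<sigma> ^^ (d - 1)\<close>
  replaces surjectivity of \<open>\<sigma>\<close>.\<close>

lemma right_idealizer_code: "right_idealizer M \<C> = E_consts"
proof
  show "right_idealizer M \<C> \<subseteq> E_consts"
  proof
    fix A assume A: "A \<in> right_idealizer M \<C>"
    then have AM: "A \<in> carrier M" and idl: "\<And>Y. Y \<in> \<C> \<Longrightarrow> Y \<otimes>\<^bsub>M\<^esub> A \<in> \<C>"
      by (auto simp: right_idealizer_def)
    have "A \<in> \<C>" using idl[OF one_in_code] AM by simp
    then obtain c where c: "c \<in> D" "A = cl c" unfolding code_eq by blast
    have cR: "c \<in> carrier R" using c D_carrier by blast
    have prod: "mon b (d - 1) \<otimes>\<^bsub>R\<^esub> c \<in> D" if b: "b \<in> carrier L" for b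
    proof -
      have m: "mon b (d - 1) \<in> D" using monom_in_D[OF b] d_ge_2 by simp
      then have "cl (mon b (d - 1)) \<in> \<C>" unfolding code_eq by blast
      then have "cl (mon b (d - 1)) \<otimes>\<^bsub>M\<^esub> A \<in> \<C>" by (rule idl)
      then have "cl (mon b (d - 1) \<otimes>\<^bsub>R\<^esub> c) \<in> \<C>" unfolding c(2) cl_mult[OF R_monom_closed[OF b] cR] .
      moreover have "(mon b (d - 1) \<otimes>\<^bsub>R\<^esub> c) i = \<zero>" if "s * n \<le> i" for i
      proof -
        have "d < i - (d - 1)" using that d_ge_2 d_le by simp
        then have "c (i - (d - 1)) = \<zero>" using c(1) by (simp add: D_def)
        then show ?thesis using cR b by (simp add: monom_mult_apply)
      qed
      ultimately show ?thesis using cl_mem_code_iff cR b by simp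
    qed
    have coeff: "(mon b (d - 1) \<otimes>\<^bsub>R\<^esub> c) (i + (d - 1)) = b \<otimes> (\<sigma> ^^ (d - 1)) (c i)"
      if "b \<in> carrier L" for b i
      using cR that by (simp add: monom_mult_apply)
    have "c i = \<zero>" if i: "0 < i" for i
    proof (cases "i = 1")
      case True
      have "(\<sigma> ^^ (d - 1)) (c 1) \<otimes> b \<in> (\<lambda>a. \<gamma> \<otimes> a) ` E" if b: "b \<in> carrier L" for b
      proof -
        have "(mon b (d - 1) \<otimes>\<^bsub>R\<^esub> c) d = (\<sigma> ^^ (d - 1)) (c 1) \<otimes> b"
          using coeff[OF b, of 1] d_ge_2 cR b by (simp add: m_comm)
        then show ?thesis using prod[OF b] unfolding D_def by auto
      qed
      then have "(\<sigma> ^^ (d - 1)) (c 1) = \<zero>"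
        using not_all_gamma_multiples[of "(\<sigma> ^^ (d - 1)) (c 1)"] cR by auto
      then show ?thesis using cR True by simp
    next
      case False
      then have "(mon \<one> (d - 1) \<otimes>\<^bsub>R\<^esub> c) (i + (d - 1)) = \<zero>"
        using prod[of \<one>] i d_ge_2 unfolding D_def by simp
      then have "\<one> \<otimes> (\<sigma> ^^ (d - 1)) (c i) = \<zero>" unfolding coeff[OF one_closed] .
      then show ?thesis using cR by simp
    qed
    then have "c = mon (c 0) 0" by (rule eq_monom_0[OF cR])
    then have "A = cl (mon (c 0) 0)" unfolding c(2) by (rule arg_cong)
    moreover have "c 0 \<in> E" using c by (simp add: D_def)
    ultimately show "A \<in> E_consts" by (rule image_eqI)
  qed
  show "E_consts \<subseteq> right_idealizer M \<C>"
  proof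
    fix A assume "A \<in> E_consts"
    then obtain e where e: "e \<in> E" "A = cl (mon e 0)" by blast
    have "Y \<otimes>\<^bsub>M\<^esub> A \<in> \<C>" if Y: "Y \<in> \<C>" for Y
    proof -
      obtain c where c: "c \<in> D" "Y = cl c" using Y unfolding code_eq by blast
      have cR: "c \<in> carrier R" using c D_carrier by blast
      obtain a where a: "a \<in> E" "c d = \<gamma> \<otimes> a" using c unfolding D_def by blast
      \<comment> \<open>The constant \<open>e\<close> reaches degree \<open>d\<close> as
        \<open>(\<sigma> ^^ d) e\<close>; the product stays in \<open>\<gamma> E\<close> because
        \<open>E\<close> is invariant under \<open>\<sigma>\<close>.\<close>
      have "\<gamma> \<otimes> a \<otimes> (\<sigma> ^^ d) e = \<gamma> \<otimes> (a \<otimes> (\<sigma> ^^ d) e)" using e a gamma by (simp add: m_assoc)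
      then have "c \<otimes>\<^bsub>R\<^esub> mon e 0 \<in> D"
        using c(1) e a cR gamma funpow_E[OF e(1), of d] unfolding D_def
        by (auto simp: mult_monom_apply intro!: bexI[of _ "a \<otimes> (\<sigma> ^^ d) e"])
      then show ?thesis using e c cR unfolding code_eq by (simp add: cl_mult)
    qed
    then show "A \<in> right_idealizer M \<C>" using e by (simp add: right_idealizer_def)
  qed
qed

section \<open>Centralizer and centre of the code\<close>

text \<open>The code contains only the constants from \<open>E\<close>. Commutation with an
  arbitrary constant \<open>b\<close> is recovered from \<open>b x\<close> and \<open>x\<close>,
  which lie in the code because \<open>d \<ge> 2\<close>, by cancelling \<open>x\<close>.\<close>

lemma centralizer_code: "centralizer M \<C> = ring_center M"
proof
  have "\<C> \<subseteq> carrier M" unfolding code_eq using D_carrier by auto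
  then show "ring_center M \<subseteq> centralizer M \<C>"
    by (auto simp: centralizer_def ring_center_def)
  show "centralizer M \<C> \<subseteq> ring_center M"
  proof
    fix A assume A: "A \<in> centralizer M \<C>"
    then have AM: "A \<in> carrier M" by (simp add: centralizer_def)
    define U where "U = cl (mon \<one> 1)"
    have U: "U \<in> carrier M" by (simp add: U_def)
    obtain Y where Y: "Y \<in> carrier M" "U \<otimes>\<^bsub>M\<^esub> Y = \<one>\<^bsub>M\<^esub>" using x_right_invertible U_def by blast
    have comm: "A \<otimes>\<^bsub>M\<^esub> cl (mon b 1) = cl (mon b 1) \<otimes>\<^bsub>M\<^esub> A" if b: "b \<in> carrier L" for b
    proof -
      have "cl (mon b 1) \<in> \<C>" unfolding code_eq using monom_in_D[OF b] d_ge_2 by simp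
      then show ?thesis using A by (simp add: centralizer_def)
    qed
    then have AX: "A \<otimes>\<^bsub>M\<^esub> U = U \<otimes>\<^bsub>M\<^esub> A" by (simp add: U_def)
    show "A \<in> ring_center M"
    proof (rule cl_commutes_all[OF AM _ AX[unfolded U_def]])
      fix b assume b: "b \<in> carrier L"
      define B where "B = cl (mon b 0)"
      have B: "B \<in> carrier M" using b by (simp add: B_def)
      have BX: "cl (mon b 1) = B \<otimes>\<^bsub>M\<^esub> U" using b by (simp add: B_def U_def cl_mult monom_mult_monom)
      have "(A \<otimes>\<^bsub>M\<^esub> B) \<otimes>\<^bsub>M\<^esub> U = A \<otimes>\<^bsub>M\<^esub> (B \<otimes>\<^bsub>M\<^esub> U)" using AM B U by (rule M.m_assoc)
      also have "\<dots> = (B \<otimes>\<^bsub>M\<^esub> U) \<otimes>\<^bsub>M\<^esub> A" using comm[OF b] unfolding BX .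
      also have "\<dots> = B \<otimes>\<^bsub>M\<^esub> (U \<otimes>\<^bsub>M\<^esub> A)" using B U AM by (rule M.m_assoc)
      also have "\<dots> = (B \<otimes>\<^bsub>M\<^esub> A) \<otimes>\<^bsub>M\<^esub> U" unfolding AX[symmetric] using B AM U by (rule M.m_assoc[symmetric])
      finally have e: "(A \<otimes>\<^bsub>M\<^esub> B) \<otimes>\<^bsub>M\<^esub> U = (B \<otimes>\<^bsub>M\<^esub> A) \<otimes>\<^bsub>M\<^esub> U" .
      have "A \<otimes>\<^bsub>M\<^esub> B = (A \<otimes>\<^bsub>M\<^esub> B) \<otimes>\<^bsub>M\<^esub> (U \<otimes>\<^bsub>M\<^esub> Y)" using AM B Y by simp
      also have "\<dots> = ((B \<otimes>\<^bsub>M\<^esub> A) \<otimes>\<^bsub>M\<^esub> U) \<otimes>\<^bsub>M\<^esub> Y"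
        unfolding e[symmetric] using AM B U Y(1) by (simp only: M.m_assoc M.m_closed)
      also have "\<dots> = (B \<otimes>\<^bsub>M\<^esub> A) \<otimes>\<^bsub>M\<^esub> (U \<otimes>\<^bsub>M\<^esub> Y)" using AM B U Y(1) by (simp only: M.m_assoc M.m_closed)
      also have "\<dots> = B \<otimes>\<^bsub>M\<^esub> A" using AM B Y by simp
      finally show "A \<otimes>\<^bsub>M\<^esub> cl (mon b 0) = cl (mon b 0) \<otimes>\<^bsub>M\<^esub> A" unfolding B_def .
    qed
  qed
qed

text \<open>A constant commutes with \<open>x\<close> exactly when \<open>\<sigma>\<close> fixes it;
  \<open>e x\<close> and \<open>\<sigma>(e) x\<close> may be compared directly since
  \<open>1 < s * n\<close>.\<close>

lemma code_center_code: "code_center M \<C> = (\<lambda>a. cl (mon a 0)) ` K"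
  unfolding code_center_def left_idealizer_code centralizer_code
proof
  show "E_consts \<inter> ring_center M \<subseteq> (\<lambda>a. cl (mon a 0)) ` K"
  proof
    fix A assume A: "A \<in> E_consts \<inter> ring_center M"
    then obtain e where e: "e \<in> E" "A = cl (mon e 0)" by blast
    then have eL: "e \<in> carrier L" by simp
    have "A \<otimes>\<^bsub>M\<^esub> cl (mon \<one> 1) = cl (mon \<one> 1) \<otimes>\<^bsub>M\<^esub> A" using A by (simp add: ring_center_def)
    then have "cl (mon e 1) = cl (mon (\<sigma> e) 1)"
      using e eL by (simp add: cl_mult monom_mult_monom)
    then have "mon e 1 = mon (\<sigma> e) 1"
      using eL d_ge_2 d_less by (intro cl_eq_bounded) (auto simp: monom_apply)
    then have "mon e 1 1 = mon (\<sigma> e) 1 1" by simp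
    then have "\<sigma> e = e" using eL by (simp add: monom_apply)
    then show "A \<in> (\<lambda>a. cl (mon a 0)) ` K" using fixed_imp_K[OF eL] e(2) by blast
  qed
  show "(\<lambda>a. cl (mon a 0)) ` K \<subseteq> E_consts \<inter> ring_center M"
  proof
    fix A assume "A \<in> (\<lambda>a. cl (mon a 0)) ` K"
    then obtain a where a: "a \<in> K" "A = cl (mon a 0)" by blast
    have p: "(\<lambda>i. if i = 0 then a else \<zero>) \<in> carrier Ky" using a by (auto simp: carrier_Ky)
    have "in_xn (\<lambda>i. if i = 0 then a else \<zero>) = mon a 0"
      using a K_mem_L n_pos by (auto simp: in_xn_def monom_apply fun_eq_iff dvd_div_eq_0_iff)
    then have "A \<in> ring_center M" using cl_in_xn_center[OF p] a by simp
    then show "A \<in> E_consts \<inter> ring_center M" using a K_E by blast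
  qed
qed

end


section \<open>The theorem\<close>

text \<open>If \<open>F 0\<close> vanished, the nonunit \<open>y\<close> would divide the
  irreducible \<open>F\<close>, so \<open>F\<close> would divide \<open>y\<close> in turn. Then
  \<open>F\<close> has degree at most one and, being monic without constant term, equals
  \<open>y\<close>.\<close>

lemma (in cyclic_galois) irreducible_const_neq_zero:
  assumes F: "F \<in> carrier Ky" and irr: "ring_irreducible\<^bsub>Ky\<^esub> F"
    and lead: "F s = \<one>" and ne: "F \<noteq> up_ring.monom Ky \<one> 1"
  shows "F 0 \<noteq> \<zero>"
proof
  assume F0: "F 0 = \<zero>"
  interpret LK: field "subring_on L K" by (rule field_LK)
  interpret U: UP_domain "subring_on L K" Ky by unfold_locales simp
  have cf: "up_ring.coeff Ky q i = q i" if "q \<in> carrier Ky" for q i using that unfolding UP_def by simp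
  define y where "y = up_ring.monom Ky \<one> 1"
  have y: "y \<in> carrier Ky" unfolding y_def by (rule U.monom_closed) simp
  have y_apply: "y i = (if i = 1 then \<one> else \<zero>)" for i by (simp add: y_def UP_def)
  define q where "q = (\<lambda>i. F (Suc i))"
  obtain N where N: "\<And>i. F i \<in> K" "\<And>i. N < i \<Longrightarrow> F i = \<zero>" using Ky_memE[OF F] by blast
  have q: "q \<in> carrier Ky" using N by (auto simp: carrier_Ky q_def intro!: exI[of _ N])
  have qL: "q i \<in> carrier L" for i using q carrier_Ky K_mem_L by blast
  have "F = y \<otimes>\<^bsub>Ky\<^esub> q"
  proof
    fix i
    show "F i = (y \<otimes>\<^bsub>Ky\<^esub> q) i"
    proof (cases i)
      case 0
      then show ?thesis using F0 qL by (simp add: Ky_mult_apply[OF y q] y_apply)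
    next
      case (Suc j)
      have "(y \<otimes>\<^bsub>Ky\<^esub> q) i = (\<Oplus>k\<in>{..i}. y k \<otimes> q (i - k))" by (rule Ky_mult_apply[OF y q])
      also have "\<dots> = y 1 \<otimes> q (i - 1)"
        using qL Suc by (intro finsum_only) (auto simp: y_apply)
      finally show ?thesis using qL[of j] Suc by (simp add: y_apply) (simp add: q_def)
    qed
  qed
  then have yF: "y divides\<^bsub>Ky\<^esub> F" using q by (auto simp: factor_def)
  have "y \<notin> Units Ky"
  proof
    assume "y \<in> Units Ky"
    then obtain z where z: "z \<in> carrier Ky" "y \<otimes>\<^bsub>Ky\<^esub> z = \<one>\<^bsub>Ky\<^esub>" by (auto simp: Units_def)
    have "z 0 \<in> carrier L" using z(1) carrier_Ky K_mem_L by blast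
    then have "(y \<otimes>\<^bsub>Ky\<^esub> z) 0 = \<zero>" by (simp add: Ky_mult_apply[OF y z(1)] y_apply)
    then show False unfolding z(2) by (simp add: Ky_one_apply)
  qed
  moreover have "irreducible Ky F" using irr by (simp add: ring_irreducible_def)
  ultimately have "\<not> properfactor Ky y F" using y by (auto simp: irreducible_def)
  then have "F divides\<^bsub>Ky\<^esub> y" using yF by (simp add: properfactor_def)
  then obtain c where c: "c \<in> carrier Ky" "y = F \<otimes>\<^bsub>Ky\<^esub> c" by (auto simp: factor_def)
  have nz: "y \<noteq> \<zero>\<^bsub>Ky\<^esub>"
  proof
    assume "y = \<zero>\<^bsub>Ky\<^esub>"
    then have "y 1 = \<zero>" by (simp add: Ky_zero_apply)
    then show False by (simp add: y_apply)
  qed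
  then have "F \<noteq> \<zero>\<^bsub>Ky\<^esub>" "c \<noteq> \<zero>\<^bsub>Ky\<^esub>" using c F by auto
  then have "deg (subring_on L K) y = deg (subring_on L K) F + deg (subring_on L K) c"
    unfolding c(2) using U.deg_mult F c(1) by blast
  moreover have "deg (subring_on L K) y \<le> 1"
    by (rule U.deg_aboveI[OF _ y]) (simp add: cf[OF y] y_apply)
  ultimately have dF: "deg (subring_on L K) F \<le> 1" by simp
  have above: "F i = \<zero>" if "1 < i" for i
  proof -
    have "deg (subring_on L K) F < i" using dF that by simp
    from U.deg_aboveD[OF this F] show ?thesis using cf[OF F] by simp
  qed
  \<comment> \<open>Only \<open>F s = \<one>\<close> is known about \<open>s\<close>; the vanishing
    of \<open>F\<close> at \<open>0\<close> and above \<open>1\<close> leaves a single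
    possibility.\<close>
  have "s = 1"
  proof (rule ccontr)
    assume "s \<noteq> 1"
    then have "F s = \<zero>" using F0 above[of s] by (cases s) auto
    then show False using lead by simp
  qed
  then have "F = y" using F0 above lead by (auto simp: fun_eq_iff y_apply nat_neq_iff less_Suc_eq)
  then show False using ne by (simp add: y_def)
qed

theorem mainTheorem17:
  fixes L :: "('a, 'b) ring_scheme"
    and K L' :: "'a set"
    and \<sigma> :: "'a \<Rightarrow> 'a"
    and n t s m l k :: nat
    and F f G :: "nat \<Rightarrow> 'a"
    and fs :: "(nat \<Rightarrow> 'a) list"
    and \<gamma> :: 'a
    and R :: "('a, nat \<Rightarrow> 'a) up_ring"
    and Ky :: "('a, nat \<Rightarrow> 'a) up_ring"
    and M :: "(nat \<Rightarrow> 'a) set ring"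
    and \<C> :: "(nat \<Rightarrow> 'a) set set"
  assumes "galois_extension_of_degree n L K"
    and "\<sigma> \<in> carrier (galois_group L K)"
    and "generate (galois_group L K) {\<sigma>} = carrier (galois_group L K)"
    and "n = 2 * t"
    and "subfield L' L" and "K \<subseteq> L'" and "ring.dimension L 2 L' (carrier L)"
    and R: "R = skew_UP L \<sigma>"
    and Ky: "Ky = UP (subring_on L K)"
    and "F \<in> carrier Ky" and "monic L F" and "ring_irreducible\<^bsub>Ky\<^esub> F"
    and "deg L F = s"
    and "F \<noteq> up_ring.monom Ky \<one>\<^bsub>L\<^esub> 1"
    and G: "G = eval_at_xn L K R n F"
    and "set fs \<subseteq> carrier R" and "factors R fs G" and "m = length fs"
    and "l = n div m"
    and "f \<in> carrier R" and "monic L f" and "ring_irreducible\<^bsub>R\<^esub> f"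
    and "f divides\<^bsub>R\<^esub> G" and "f \<notin> ring_center R"
    and "\<gamma> \<in> carrier L" and "\<gamma> \<noteq> \<zero>\<^bsub>L\<^esub>"
    and M: "M = R Quot (PIdl\<^bsub>R\<^esub> G)"
    and code: "\<C> = D_code L L' R (PIdl\<^bsub>R\<^esub> G) (s * k * l) \<gamma>"
    and "1 \<le> k" and "2 * k \<le> m" and "s * k * l \<ge> 2"
  shows "subring_on M (left_idealizer M \<C>) \<simeq> subring_on L L' \<and>
    subring_on M (right_idealizer M \<C>) \<simeq> subring_on L L' \<and>
    subring_on M (centralizer M \<C>) \<simeq> subring_on M (ring_center M) \<and>
    subring_on M (centralizer M \<C>) \<simeq> Ky Quot (PIdl\<^bsub>Ky\<^esub> F) \<and>
    subring_on M (code_center M \<C>) \<simeq> subring_on L K"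
proof -
  have "field L" using assms(1) by (simp add: galois_extension_of_degree_def)
  then interpret L: field L .
  interpret galois: cyclic_galois L K \<sigma> n
    using assms(1-3) by unfold_locales
  have F: "F \<in> carrier (UP (subring_on L K))" using assms(10) Ky by simp
  have FK: "F i \<in> K" for i using F galois.carrier_Ky by blast
  interpret UL: UP_ring L "UP L" by unfold_locales simp
  \<comment> \<open>The hypotheses measure the degree of \<open>F\<close> in \<open>UP L\<close>, so
    its vanishing above \<open>s\<close> is read off there.\<close>
  have FL: "F \<in> carrier (UP L)"
  proof -
    obtain N where N: "\<And>i. F i \<in> K" "\<And>i. N < i \<Longrightarrow> F i = \<zero>\<^bsub>L\<^esub>" using galois.Ky_memE[OF F] by blast
    then have "F \<in> up L" using galois.K_mem_L unfolding up_def bound_def by blast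
    then show ?thesis unfolding UP_def by simp
  qed
  have lead: "F s = \<one>\<^bsub>L\<^esub>" using assms(11,13) by (simp add: monic_def)
  have above: "F i = \<zero>\<^bsub>L\<^esub>" if "s < i" for i
  proof -
    have "deg L F < i" using that assms(13) by simp
    from UL.deg_aboveD[OF this FL] show ?thesis using FL unfolding UP_def by simp
  qed
  have const: "F 0 \<noteq> \<zero>\<^bsub>L\<^esub>"
    using galois.irreducible_const_neq_zero[OF F _ lead] assms(12,14) Ky by blast
  have n2: "2 \<le> n" using galois.n_pos assms(4) by simp
  \<comment> \<open>\<open>l\<close> is a rounded-down quotient, for which this inequality always
    holds.\<close>
  have "m * l \<le> n" using assms(19) by simp
  have "2 * (s * k * l) = s * (2 * k * l)" by simp
  also have "\<dots> \<le> s * (m * l)" using \<open>2 * k \<le> m\<close> by (intro mult_le_mono) auto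
  also have "\<dots> \<le> s * n" using \<open>m * l \<le> n\<close> by simp
  finally have d_le: "2 * (s * k * l) \<le> s * n" .
  interpret code: skew_code L K \<sigma> n F s L' \<gamma> "s * k * l"
  proof (intro skew_code.intro skew_quotient.intro skew_code_axioms.intro skew_quotient_axioms.intro)
    show "cyclic_galois L K \<sigma> n" by unfold_locales
    show "F i \<in> K" for i by (rule FK)
    show "F s = \<one>\<^bsub>L\<^esub>" by (rule lead)
    show "s < i \<Longrightarrow> F i = \<zero>\<^bsub>L\<^esub>" for i by (rule above)
    show "F 0 \<noteq> \<zero>\<^bsub>L\<^esub>" by (rule const)
    show "2 \<le> n" by (rule n2)
    show "subfield L' L" "K \<subseteq> L'" "ring.dimension L 2 L' (carrier L)" by fact+
    show "\<gamma> \<in> carrier L" "\<gamma> \<noteq> \<zero>\<^bsub>L\<^esub>" "2 \<le> s * k * l" by fact+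
    show "2 * (s * k * l) \<le> s * n" by (rule d_le)
  qed
  have GF: "G = galois.in_xn F" unfolding G R by (rule galois.eval_at_xn_eq[OF F])
  have sn: "0 < s * n" using code.s_pos galois.n_pos by simp
  have const_iso: "subring_on M ((\<lambda>a. PIdl\<^bsub>R\<^esub> G +>\<^bsub>R\<^esub> up_ring.monom R a 0) ` A) \<simeq> subring_on L A"
    if "subfield A L" for A
    using code.constants_iso[OF subfieldE(1)[OF that] sn] unfolding M R GF .
  show ?thesis
    using const_iso[OF assms(5)] const_iso[OF galois.subfield_K] code.ring_center_iso[OF code.s_pos]
      ring_iso_refl[of "subring_on M (ring_center M)"]
    unfolding code M R GF Ky code.left_idealizer_code code.right_idealizer_code
      code.centralizer_code code.code_center_code
    by blast
qed

end
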